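(* Consider the quantum switch on the graph $G=(V,E)$ described in the context, with coherence factor $\Gamma_{\mathrm{coh}}>0$ and capacity region $\mathcal C$, and let $\epsilon>0$. Suppose that the request arrival rate vector $\boldsymbol\nu=(\nu_e)_{e\in E}$ satisfies $$\frac{1+\epsilon}{\Gamma_{\mathrm{coh}}}\,\boldsymbol\nu\in\mathcal C .$$ Let $\mathcal V(\mathbf R)=\frac12\sum_{e\in E}R_e^2$. Then there exist a frame length $T_\epsilon\in\{1,2,\dots\}$, a constant $\delta>0$ and a finite set $\mathcal B\subset\mathbb Z_{\ge0}^{E}$ such that, when the switch is operated under the LP-based frame scheduling algorithm with frame length $T=T_\epsilon$, for all $k\in\{0,1,2,\dots\}$, $$\mathbb E\big[\mathcal V(\mathbf R((k+1)T_\epsilon))-\mathcal V(\mathbf R(kT_\epsilon))\,\big|\,\mathbf L(kT_\epsilon),\mathbf R(kT_\epsilon)\big]\le-\delta$$ whenever $\mathbf R(kT_\epsilon)\notin\mathcal B$.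
   Context: **Switch model.** $G=(V,E)$ is a finite graph; $\delta(v)$ denotes the set of edges incident to $v\in V$, and $E(S)$ the set of edges with both endpoints in $S\subseteq V$. The endpoints of $e$ are $u_e,v_e$. Time is slotted, $t=0,1,2,\dots$. Node $v$ stores $L_v(t)\in\{0,\dots,B_v\}$ entanglements, where $B_v\ge1$ is a finite integer. Edge $e$ has an infinite-buffer request queue $R_e(t)\in\mathbb Z_{\ge0}$. Parameters $\lambda_v,\mu_v\in(0,1)$ are given for each $v$. A matching is a set of edges no two of which share a node; $\mathcal M$ is the set of all matchings of $G$ and $\mathbf 1_M\in\{0,1\}^E$ is the indicator vector of $M$. Events in slot $t$ occur in this order: 1. A matching $M(t)\in\mathcal M$ is chosen. 2. Edge $e=(u,v)$ is served, $S_e(t)=1$, if and only if $e\in M(t)$, $R_e(t)>0$, $L_u(t)>0$ and $L_v(t)>0$; otherwise $S_e(t)=0$. A service removes one request from $R_e$ and one entanglement from each of $L_u,L_v$. 3. Each remaining entanglement at node $v$ is lost independently with probability $\mu_v$; let $D_v(t)\sim\mathrm{Binom}(L_v(t)-\sum_{e\in\delta(v)}S_e(t),\mu_v)$ be the number lost. 4. A new entanglement arrives at $v$ with probability $\lambda_v$ (Bernoulli variable $Y_v(t)$), and $A_e(t)\in\mathbb Z_{\ge0}$ requests arrive at edge $e$, where $A_e(t)$ is i.i.d. over $t$ with mean $\nu_e$ and finite variance $\sigma_e^2$. Thus $R_e(t+1)=R_e(t)-S_e(t)+A_e(t)$ and $L_v(t+1)=\min\big(B_v,\,L_v(t)-\sum_{e\in\delta(v)}S_e(t)-D_v(t)+Y_v(t)\big)$.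 Entanglement arrivals, decoherence events, request arrivals and scheduling randomness are mutually independent, and independent across nodes and slots. **LP-based frame scheduling algorithm with frame length $T$.** At each time $t=kT$, $k=0,1,2,\dots$, observe $\mathbf R(kT)$, set $w_e=R_e(kT)$, and let $\mathbf x^*$ be an optimal solution of the LP: maximize $\sum_{e}w_ex_e$ subject to $\sum_{e\in\delta(v)}x_e\le\lambda_v$ for all $v\in V$; $\sum_{e\in E(S)}x_e\le\frac{|S|-1}2$ for all $S\subseteq V$ with $|S|$ odd and $|S|\ge3$; and $x_e\ge0$ for all $e\in E$. Since $\mathbf x^*$ lies in the convex hull of $\{\mathbf 1_M:M\in\mathcal M\}$, compute probabilities $(p_M)_{M\in\mathcal M}$ with $p_M\ge0$, $\sum_Mp_M=1$ and $\sum_Mp_M\mathbf 1_M=\mathbf x^*$ (the choice of $\mathbf x^*$ and $(p_M)$ being a function of $\mathbf R(kT)$). In each slot $t=kT,\dots,(k+1)T-1$, independently choose $M(t)=M$ with probability $p_M$. **Reference chain and availability.** For node $u$, the reference chain $\tilde L_u(t)$ on $\{0,\dots,B_u\}$ evolves as follows. From state $i$, draw independent $S\sim\mathrm{Bernoulli}(p_u)$ with $p_u=\lambda_u$ and $A\sim\mathrm{Bernoulli}(\lambda_u)$, draw $K\sim\mathrm{Binom}(\max(0,i-S),1-\mu_u)$ (independent of $A$ given $S$), and move to $\min(B_u,K+A)$. Let $C_u=1-\pi_0$, where $\pi$ is its stationary distribution. Define $\Gamma_{\mathrm{coh}}=\min_{e=(u,v)\in E}(C_u+C_v-1)^+$,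 where $x^+=\max(x,0)$. **Capacity region.** A request-agnostic policy $\pi$ chooses matching $M$ with probability $\pi(M\mid\mathbf L)$ when the entanglement state is $\mathbf L$. Under it, every edge of the chosen matching with both endpoint buffers nonempty is served (request-queue emptiness is ignored), so $\mathbf L(t)$ is a finite Markov chain evolving as $L_v(t+1)=\min\big(B_v,\,L_v(t)-\sum_{e\in\delta(v)}\hat S_e(t)-\hat D_v(t)+Y_v(t)\big)$ for all $v\in V$, where $M(t)=M$ with probability $\pi(M\mid\mathbf L(t))$, $\hat S_e(t)=1$ if $e\in M(t)$, $L_{u_e}(t)>0$ and $L_{v_e}(t)>0$, and $\hat S_e(t)=0$ otherwise, $\hat D_v(t)\sim\mathrm{Binom}(L_v(t)-\sum_{e\in\delta(v)}\hat S_e(t),\mu_v)$ and $Y_v(t)\sim\mathrm{Bernoulli}(\lambda_v)$, with scheduling, decoherence and entanglement-arrival randomness independent of each other and across nodes and slots; $d_\pi$ denotes its stationary distribution. Then $$\mathcal C=\Big\{\boldsymbol\nu\in\mathbb R_{\ge0}^E:\ \exists\,\pi\text{ such that }\nu_e<\sum_{\mathbf L:\,L_{u_e}>0,\,L_{v_e}>0}\ \sum_{M\ni e}\pi(M\mid\mathbf L)\,d_\pi(\mathbf L)\ \ \forall e\in E\Big\}.$$ *)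

theory Defs
  imports "HOL-Probability.Probability"
begin

(* The types 'v and 'e are the node set V and the edge set E. Parallel edges are
   not excluded; loops are, see valid_switch. *)
record ('v, 'e) switch =
  end_u :: "'e \<Rightarrow> 'v"
  end_v :: "'e \<Rightarrow> 'v"
  buf :: "'v \<Rightarrow> nat"
  lam :: "'v \<Rightarrow> real"
  mu :: "'v \<Rightarrow> real"

definition valid_switch :: "('v, 'e) switch \<Rightarrow> bool" where
  "valid_switch N \<longleftrightarrow>
     (\<forall>e. end_u N e \<noteq> end_v N e) \<and>
     (\<forall>v. 1 \<le> buf N v \<and> 0 < lam N v \<and> lam N v < 1 \<and> 0 < mu N v \<and> mu N v < 1)"

definition incident :: "('v, 'e) switch \<Rightarrow> 'v \<Rightarrow> 'e set" where
  "incident N v = {e. end_u N e = v \<or> end_v N e = v}"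

definition edges_in :: "('v, 'e) switch \<Rightarrow> 'v set \<Rightarrow> 'e set" where
  "edges_in N S = {e. end_u N e \<in> S \<and> end_v N e \<in> S}"

definition matchings :: "('v, 'e) switch \<Rightarrow> 'e set set" where
  "matchings N = {M. \<forall>e\<in>M. \<forall>f\<in>M. e \<noteq> f \<longrightarrow>
     {end_u N e, end_v N e} \<inter> {end_u N f, end_v N f} = {}}"

definition mem_states :: "('v, 'e) switch \<Rightarrow> ('v \<Rightarrow> nat) set" where
  "mem_states N = {L. \<forall>v. L v \<le> buf N v}"

(* Evolution of the entanglement buffers once the service vector S is fixed: decoherence D,
   then arrivals Y. The subtractions on nat never truncate for the vectors S used below,
   since S is supported on a matching of edges with nonempty endpoint buffers, and D is at
   most the number of remaining entanglements. *)
definition mem_step ::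
    "('v::finite, 'e::finite) switch \<Rightarrow> ('e \<Rightarrow> nat) \<Rightarrow> ('v \<Rightarrow> nat) \<Rightarrow> ('v \<Rightarrow> nat) pmf" where
  "mem_step N S L = do {
     D \<leftarrow> Pi_pmf UNIV 0 (\<lambda>v. binomial_pmf (L v - (\<Sum>e\<in>incident N v. S e)) (mu N v));
     Y \<leftarrow> Pi_pmf UNIV False (\<lambda>v. bernoulli_pmf (lam N v));
     return_pmf (\<lambda>v. min (buf N v) (L v - (\<Sum>e\<in>incident N v. S e) - D v + of_bool (Y v)))
   }"

(* arr is the joint law of the vector (A_e(t))_e; no independence across edges is imposed. *)
definition request_arrivals :: "('e \<Rightarrow> nat) pmf \<Rightarrow> ('e \<Rightarrow> real) \<Rightarrow> ('e \<Rightarrow> real) \<Rightarrow> bool" where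
  "request_arrivals arr \<nu> \<sigma> \<longleftrightarrow>
     (\<forall>e. integrable (measure_pmf arr) (\<lambda>A. real (A e)) \<and>
          measure_pmf.expectation arr (\<lambda>A. real (A e)) = \<nu> e \<and>
          integrable (measure_pmf arr) (\<lambda>A. (real (A e) - \<nu> e)\<^sup>2) \<and>
          measure_pmf.variance arr (\<lambda>A. real (A e)) = (\<sigma> e)\<^sup>2)"

(* One slot started in (L, R), where the matching is drawn from p. *)
definition switch_step ::
    "('v::finite, 'e::finite) switch \<Rightarrow> ('e \<Rightarrow> nat) pmf \<Rightarrow> 'e set pmf \<Rightarrow>
     ('v \<Rightarrow> nat) \<times> ('e \<Rightarrow> nat) \<Rightarrow> (('v \<Rightarrow> nat) \<times> ('e \<Rightarrow> nat)) pmf" where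
  "switch_step N arr p = (\<lambda>(L, R). do {
     M \<leftarrow> p;
     let S = (\<lambda>e. of_bool (e \<in> M \<and> R e > 0 \<and> L (end_u N e) > 0 \<and> L (end_v N e) > 0));
     L' \<leftarrow> mem_step N S L;
     A \<leftarrow> arr;
     return_pmf (L', \<lambda>e. R e - S e + A e)
   })"

definition lp_feasible :: "('v::finite, 'e::finite) switch \<Rightarrow> ('e \<Rightarrow> real) \<Rightarrow> bool" where
  "lp_feasible N x \<longleftrightarrow>
     (\<forall>v. (\<Sum>e\<in>incident N v. x e) \<le> lam N v) \<and>
     (\<forall>S. odd (card S) \<and> card S \<ge> 3 \<longrightarrow> (\<Sum>e\<in>edges_in N S. x e) \<le> (real (card S) - 1) / 2) \<and>
     (\<forall>e. 0 \<le> x e)"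

definition lp_optimal ::
    "('v::finite, 'e::finite) switch \<Rightarrow> ('e \<Rightarrow> real) \<Rightarrow> ('e \<Rightarrow> real) \<Rightarrow> bool" where
  "lp_optimal N w x \<longleftrightarrow>
     lp_feasible N x \<and> (\<forall>y. lp_feasible N y \<longrightarrow> (\<Sum>e\<in>UNIV. w e * y e) \<le> (\<Sum>e\<in>UNIV. w e * x e))"

(* xs R is the chosen optimal LP solution and p R the chosen decomposition of it over
   matchings, both functions of the queue vector R observed at the start of the frame. *)
definition lp_frame_rule ::
    "('v::finite, 'e::finite) switch \<Rightarrow>
     (('e \<Rightarrow> nat) \<Rightarrow> 'e \<Rightarrow> real) \<Rightarrow> (('e \<Rightarrow> nat) \<Rightarrow> 'e set pmf) \<Rightarrow> bool" where
  "lp_frame_rule N xs p \<longleftrightarrow>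
     (\<forall>R. lp_optimal N (\<lambda>e. real (R e)) (xs R) \<and>
          set_pmf (p R) \<subseteq> matchings N \<and>
          (\<forall>e. (\<Sum>M\<in>matchings N. pmf (p R) M * indicator M e) = xs R e))"

(* Law of the trajectory [(L(0),R(0)), ..., (L(t),R(t))]. In slot t the frame started at
   time (t div T) * T. *)
primrec switch_traj ::
    "('v::finite, 'e::finite) switch \<Rightarrow> ('e \<Rightarrow> nat) pmf \<Rightarrow> nat \<Rightarrow> (('e \<Rightarrow> nat) \<Rightarrow> 'e set pmf) \<Rightarrow>
     (('v \<Rightarrow> nat) \<times> ('e \<Rightarrow> nat)) pmf \<Rightarrow> nat \<Rightarrow> (('v \<Rightarrow> nat) \<times> ('e \<Rightarrow> nat)) list pmf" where
  "switch_traj N arr T p init 0 = map_pmf (\<lambda>s. [s]) init"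
| "switch_traj N arr T p init (Suc t) = do {
     h \<leftarrow> switch_traj N arr T p init t;
     s \<leftarrow> switch_step N arr (p (snd (h ! (t div T * T)))) (h ! t);
     return_pmf (h @ [s])
   }"

(* Only applied to finite chains in which some fixed state is reached from every state in one
   step with positive probability, so that the stationary distribution exists and is unique. *)
definition stationary_dist :: "'s set \<Rightarrow> ('s \<Rightarrow> 's pmf) \<Rightarrow> 's pmf" where
  "stationary_dist X K = (THE d. set_pmf d \<subseteq> X \<and> bind_pmf d K = d)"

definition ref_step :: "('v, 'e) switch \<Rightarrow> 'v \<Rightarrow> nat \<Rightarrow> nat pmf" where
  "ref_step N u i = do {
     S \<leftarrow> bernoulli_pmf (lam N u);
     A \<leftarrow> bernoulli_pmf (lam N u);
     K \<leftarrow> binomial_pmf (i - of_bool S) (1 - mu N u);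
     return_pmf (min (buf N u) (K + of_bool A))
   }"

definition availability :: "('v, 'e) switch \<Rightarrow> 'v \<Rightarrow> real" where
  "availability N u = 1 - pmf (stationary_dist {0..buf N u} (ref_step N u)) 0"

definition gamma_coh :: "('v, 'e::finite) switch \<Rightarrow> real" where
  "gamma_coh N = (MIN e. max 0 (availability N (end_u N e) + availability N (end_v N e) - 1))"

definition agnostic_step ::
    "('v::finite, 'e::finite) switch \<Rightarrow> (('v \<Rightarrow> nat) \<Rightarrow> 'e set pmf) \<Rightarrow> ('v \<Rightarrow> nat) \<Rightarrow> ('v \<Rightarrow> nat) pmf" where
  "agnostic_step N pol L = do {
     M \<leftarrow> pol L;
     mem_step N (\<lambda>e. of_bool (e \<in> M \<and> L (end_u N e) > 0 \<and> L (end_v N e) > 0)) L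
   }"

definition capacity_region :: "('v::finite, 'e::finite) switch \<Rightarrow> ('e \<Rightarrow> real) set" where
  "capacity_region N = {\<nu>. (\<forall>e. 0 \<le> \<nu> e) \<and>
     (\<exists>pol. (\<forall>L\<in>mem_states N. set_pmf (pol L) \<subseteq> matchings N) \<and>
        (\<forall>e. \<nu> e <
           (\<Sum>L\<in>{L \<in> mem_states N. L (end_u N e) > 0 \<and> L (end_v N e) > 0}.
              \<Sum>M\<in>{M \<in> matchings N. e \<in> M}.
                pmf (pol L) M * pmf (stationary_dist (mem_states N) (agnostic_step N pol)) L)))}"

definition lyapunov :: "('e::finite \<Rightarrow> nat) \<Rightarrow> real" where
  "lyapunov R = (1 / 2) * (\<Sum>e\<in>UNIV. (real (R e))\<^sup>2)"

(* E[V(R((k+1)T)) - V(R(kT)) | L(kT), R(kT)] as a random variable on the trajectories up to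
   time (k+1)T. *)
definition frame_drift ::
    "('v::finite, 'e::finite) switch \<Rightarrow> ('e \<Rightarrow> nat) pmf \<Rightarrow> nat \<Rightarrow> (('e \<Rightarrow> nat) \<Rightarrow> 'e set pmf) \<Rightarrow>
     (('v \<Rightarrow> nat) \<times> ('e \<Rightarrow> nat)) pmf \<Rightarrow> nat \<Rightarrow> (('v \<Rightarrow> nat) \<times> ('e \<Rightarrow> nat)) list \<Rightarrow> real" where
  "frame_drift N arr T p init k =
     real_cond_exp (measure_pmf (switch_traj N arr T p init ((k + 1) * T)))
       (vimage_algebra UNIV (\<lambda>h. h ! (k * T)) (count_space UNIV))
       (\<lambda>h. lyapunov (snd (h ! ((k + 1) * T))) - lyapunov (snd (h ! (k * T))))"

end

theory Submission
  imports Defs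
begin

text \<open>
  The drift of the quadratic Lyapunov function over a frame is, up to a bounded term,
  \<open>\<Sum>e. R e * (T * \<nu> e - E (services of e in the frame))\<close>, where \<open>R\<close> is the queue vector at the
  start of the frame. It is negative for large \<open>R\<close> because of two comparisons.

  The first bounds the services from below. Within a frame the matching of each slot is drawn
  independently of the current state, and it contains \<open>e\<close> with probability \<open>x e\<close>. A long queue
  cannot run empty within the frame, so \<open>e\<close> is then served in a slot with probability \<open>x e\<close> times
  the probability that both end buffers are nonempty. The matching covers a node \<open>v\<close> with
  probability at most \<open>\<Sum>e\<in>incident N v. x e \<le> lam N v\<close>, so the buffer at \<open>v\<close> stochastically
  dominates the reference chain started empty (\<open>switch_step_dominates\<close>, \<open>evolve_dominates\<close>). By
  Doeblin's condition, with the empty buffer as the common target, the reference chain converges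
  geometrically to its stationary law (\<open>geometric_ergodicity\<close>). A union bound over the two ends
  (\<open>edge_available_ge\<close>) then shows that, for a suitable frame length \<open>T\<close>, the edge \<open>e\<close> is served
  at least \<open>T * g * x e\<close> times on average, where \<open>g = gamma_coh N / (1 + \<epsilon>)\<close>
  (\<open>frame_length_exists\<close>, \<open>chain_queue_drift\<close>).

  The second bounds the weight of the schedule from below. The long-run service rates \<open>r\<close> of a
  request-agnostic policy are feasible for the LP (\<open>agnostic_rate_feasible\<close>): by stationarity
  a node cannot use more entanglements than arrive, and the service vector of a slot is supported
  on a matching. Hence \<open>\<Sum>e. R e * x e \<ge> \<Sum>e. R e * r e\<close>, while \<open>\<nu> e < g * r e\<close> for every edge by
  hypothesis. With \<open>c\<close> the least of the gaps \<open>g * r e - \<nu> e\<close>, the drift is at most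
  \<open>D - T * c * (\<Sum>e. R e)\<close> for a constant \<open>D\<close>.

  The state space is countable, so the conditional expectation given the state at the start of
  the frame is evaluated atom by atom (\<open>frame_drift_eq\<close>).
\<close>

section \<open>Expectations under discrete laws\<close>

text \<open>The tower rule for real functions that are integrable but possibly unbounded.\<close>

lemma expectation_bind_pmf:
  fixes h :: "'b \<Rightarrow> real"
  assumes int: "integrable (measure_pmf (bind_pmf p f)) h"
  shows "measure_pmf.expectation (bind_pmf p f) h
           = measure_pmf.expectation p (\<lambda>x. measure_pmf.expectation (f x) h)"
proof -
  let ?P = "\<lambda>x. \<integral>\<^sup>+y. ennreal (h y) \<partial>measure_pmf (f x)"
  let ?N = "\<lambda>x. \<integral>\<^sup>+y. ennreal (- h y) \<partial>measure_pmf (f x)"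
  have finP: "(\<integral>\<^sup>+x. ?P x \<partial>measure_pmf p) \<noteq> \<infinity>" and finN: "(\<integral>\<^sup>+x. ?N x \<partial>measure_pmf p) \<noteq> \<infinity>"
    using int unfolding real_integrable_def by simp_all
  have aeP: "AE x in measure_pmf p. ?P x \<noteq> \<infinity>" and aeN: "AE x in measure_pmf p. ?N x \<noteq> \<infinity>"
    using nn_integral_PInf_AE[OF _ finP] nn_integral_PInf_AE[OF _ finN] by simp_all
  have iP: "integrable (measure_pmf p) (\<lambda>x. enn2real (?P x))"
    and vP: "(\<integral>x. enn2real (?P x) \<partial>measure_pmf p) = enn2real (\<integral>\<^sup>+x. ?P x \<partial>measure_pmf p)"
  proof -
    have eq: "(\<integral>\<^sup>+x. ennreal (enn2real (?P x)) \<partial>measure_pmf p) = (\<integral>\<^sup>+x. ?P x \<partial>measure_pmf p)"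
      using aeP by (intro nn_integral_cong_AE) (auto simp: less_top elim!: eventually_mono)
    show "integrable (measure_pmf p) (\<lambda>x. enn2real (?P x))"
      by (rule integrableI_nonneg) (use eq finP in \<open>auto simp: less_top\<close>)
    show "(\<integral>x. enn2real (?P x) \<partial>measure_pmf p) = enn2real (\<integral>\<^sup>+x. ?P x \<partial>measure_pmf p)"
      by (subst integral_eq_nn_integral) (auto simp: eq)
  qed
  have iN: "integrable (measure_pmf p) (\<lambda>x. enn2real (?N x))"
    and vN: "(\<integral>x. enn2real (?N x) \<partial>measure_pmf p) = enn2real (\<integral>\<^sup>+x. ?N x \<partial>measure_pmf p)"
  proof -
    have eq: "(\<integral>\<^sup>+x. ennreal (enn2real (?N x)) \<partial>measure_pmf p) = (\<integral>\<^sup>+x. ?N x \<partial>measure_pmf p)"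
      using aeN by (intro nn_integral_cong_AE) (auto simp: less_top elim!: eventually_mono)
    show "integrable (measure_pmf p) (\<lambda>x. enn2real (?N x))"
      by (rule integrableI_nonneg) (use eq finN in \<open>auto simp: less_top\<close>)
    show "(\<integral>x. enn2real (?N x) \<partial>measure_pmf p) = enn2real (\<integral>\<^sup>+x. ?N x \<partial>measure_pmf p)"
      by (subst integral_eq_nn_integral) (auto simp: eq)
  qed
  have inner: "AE x in measure_pmf p.
      measure_pmf.expectation (f x) h = enn2real (?P x) - enn2real (?N x)"
    using aeP aeN
  proof eventually_elim
    case (elim x)
    then have "integrable (measure_pmf (f x)) h" by (simp add: real_integrable_def)
    then show ?case by (rule real_lebesgue_integral_def)
  qed
  have "measure_pmf.expectation p (\<lambda>x. measure_pmf.expectation (f x) h)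
      = measure_pmf.expectation p (\<lambda>x. enn2real (?P x) - enn2real (?N x))"
    by (rule integral_cong_AE) (use inner in auto)
  also have "\<dots> = enn2real (\<integral>\<^sup>+x. ?P x \<partial>measure_pmf p) - enn2real (\<integral>\<^sup>+x. ?N x \<partial>measure_pmf p)"
    using iP iN by (simp add: vP vN)
  also have "\<dots> = measure_pmf.expectation (bind_pmf p f) h"
    using real_lebesgue_integral_def[OF int] by simp
  finally show ?thesis by simp
qed

lemma integrable_pmf_bounded:
  fixes h :: "'a \<Rightarrow> real"
  assumes "\<And>x. x \<in> set_pmf p \<Longrightarrow> \<bar>h x\<bar> \<le> B"
  shows "integrable (measure_pmf p) h"
  by (rule measure_pmf.integrable_const_bound[where B = B])
     (use assms in \<open>auto simp: AE_measure_pmf_iff\<close>)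

lemma integrable_pmf_unit:
  fixes h :: "'a \<Rightarrow> real"
  assumes "\<And>x. 0 \<le> h x" "\<And>x. h x \<le> 1"
  shows "integrable (measure_pmf p) h"
  by (rule integrable_pmf_bounded[where B = 1]) (simp add: abs_le_iff assms order_trans[OF _ assms(1)])

lemma expectation_bind_unit:
  fixes h :: "'a \<Rightarrow> real"
  assumes "\<And>x. 0 \<le> h x" "\<And>x. h x \<le> 1"
  shows "measure_pmf.expectation (bind_pmf p f) h
           = measure_pmf.expectation p (\<lambda>x. measure_pmf.expectation (f x) h)"
  by (rule expectation_bind_pmf[OF integrable_pmf_unit]) (use assms in auto)

lemma expectation_unit:
  fixes h :: "'a \<Rightarrow> real"
  assumes "\<And>x. 0 \<le> h x" "\<And>x. h x \<le> 1"
  shows "0 \<le> measure_pmf.expectation p h" "measure_pmf.expectation p h \<le> 1"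
proof -
  show "0 \<le> measure_pmf.expectation p h"
    by (rule Bochner_Integration.integral_nonneg) (rule assms)
  have "measure_pmf.expectation p h \<le> measure_pmf.expectation p (\<lambda>_. 1)"
    by (rule integral_mono[OF integrable_pmf_unit]) (use assms in auto)
  then show "measure_pmf.expectation p h \<le> 1" by simp
qed

lemma integral_pmf_mono:
  fixes f g :: "'a \<Rightarrow> real"
  assumes "integrable (measure_pmf p) f" "integrable (measure_pmf p) g"
    and "\<And>x. x \<in> set_pmf p \<Longrightarrow> f x \<le> g x"
  shows "measure_pmf.expectation p f \<le> measure_pmf.expectation p g"
  by (rule integral_mono_AE) (use assms in \<open>auto simp: AE_measure_pmf_iff\<close>)

section \<open>Finite chains with a common one-step target\<close>

text \<open>The law after \<open>n\<close> steps of the kernel \<open>K\<close> started from the law \<open>d\<close>.\<close>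

primrec evolve :: "('s \<Rightarrow> 's pmf) \<Rightarrow> nat \<Rightarrow> 's pmf \<Rightarrow> 's pmf" where
  "evolve K 0 d = d"
| "evolve K (Suc n) d = evolve K n (bind_pmf d K)"

lemma evolve_Suc_right: "evolve K (Suc n) d = bind_pmf (evolve K n d) K"
  by (induction n arbitrary: d) simp_all

lemma evolve_bind: "evolve K n (bind_pmf d f) = bind_pmf d (\<lambda>x. evolve K n (f x))"
  by (induction n arbitrary: f) (simp_all add: bind_assoc_pmf)

lemma evolve_stationary: "bind_pmf d K = d \<Longrightarrow> evolve K n d = d"
  by (induction n) simp_all

text \<open>If a finite chain can move to the state \<open>z\<close> from every state, then each row of its kernel gives
  \<open>z\<close> at least some common mass \<open>\<beta> > 0\<close> (Doeblin's condition). So a step from \<open>x\<close> resets the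
  chain to \<open>z\<close> with probability \<open>\<beta>\<close> and follows a residual kernel \<open>Q\<close> otherwise.\<close>

lemma doeblin_decomposition:
  assumes fin: "finite X" and zX: "z \<in> X"
    and K: "\<And>x. x \<in> X \<Longrightarrow> set_pmf (K x) \<subseteq> X" "\<And>x. x \<in> X \<Longrightarrow> z \<in> set_pmf (K x)"
  obtains \<beta> Q where "0 < \<beta>" "\<beta> < (1::real)" "\<And>x. set_pmf (Q x) \<subseteq> X"
    "\<And>x. x \<in> X \<Longrightarrow>
       K x = bind_pmf (bernoulli_pmf \<beta>) (\<lambda>b. if b then return_pmf z else Q x)"
proof -
  \<comment> \<open>Half of the minimal mass of \<open>z\<close>, so that \<open>\<beta> < 1\<close> and the residual kernel can be normalised.\<close>
  define \<beta> where "\<beta> = Min ((\<lambda>x. pmf (K x) z) ` X) / 2"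
  have ne: "X \<noteq> {}" using zX by auto
  have \<beta>le: "2 * \<beta> \<le> pmf (K x) z" if "x \<in> X" for x
    unfolding \<beta>_def using fin that by simp
  have "0 < Min ((\<lambda>x. pmf (K x) z) ` X)"
    using fin ne K(2) by (subst Min_gr_iff) (auto simp: pmf_positive)
  then have \<beta>0: "0 < \<beta>" by (simp add: \<beta>_def)
  have \<beta>1: "\<beta> < 1" using \<beta>le[OF zX] pmf_le_1[of "K z" z] \<beta>0 by linarith
  define q where "q x j = (pmf (K x) j - (if j = z then \<beta> else 0)) / (1 - \<beta>)" for x j
  have qnn: "0 \<le> q x j" if "x \<in> X" for x j
    using \<beta>le[OF that] \<beta>0 \<beta>1 by (auto simp: q_def)
  have qsum: "(\<integral>\<^sup>+j. ennreal (q x j) \<partial>count_space UNIV) = 1" if x: "x \<in> X" for x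
  proof -
    have out: "q x j = 0" if "j \<notin> X" for j
      using K(1)[OF x] that zX by (auto simp: q_def set_pmf_iff)
    have "(\<integral>\<^sup>+j. ennreal (q x j) \<partial>count_space UNIV) = (\<Sum>j\<in>X. ennreal (q x j))"
      by (rule nn_integral_count_space'[OF fin]) (use out in auto)
    also have "\<dots> = ennreal (\<Sum>j\<in>X. q x j)" by (rule sum_ennreal) (rule qnn[OF x])
    also have "(\<Sum>j\<in>X. q x j) = ((\<Sum>j\<in>X. pmf (K x) j) - (\<Sum>j\<in>X. if j = z then \<beta> else 0)) / (1 - \<beta>)"
      by (simp add: q_def sum_subtractf flip: sum_divide_distrib)
    also have "(\<Sum>j\<in>X. if j = z then \<beta> else 0) = \<beta>" using fin zX by simp
    also have "(\<Sum>j\<in>X. pmf (K x) j) = 1" by (rule sum_pmf_eq_1[OF fin K(1)[OF x]])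
    finally show ?thesis using \<beta>1 by simp
  qed
  define Q where "Q x = (if x \<in> X then embed_pmf (q x) else return_pmf z)" for x
  have pQ: "pmf (Q x) j = q x j" if "x \<in> X" for x j
    unfolding Q_def using that pmf_embed_pmf[of "q x"] qnn[OF that] qsum[OF that] by auto
  have setQ: "set_pmf (Q x) \<subseteq> X" for x
  proof (cases "x \<in> X")
    case True
    show ?thesis
    proof
      fix j assume j: "j \<in> set_pmf (Q x)"
      show "j \<in> X"
      proof (rule ccontr)
        assume "j \<notin> X"
        then have "pmf (K x) j = 0" "j \<noteq> z" using K(1)[OF True] zX by (auto simp: set_pmf_iff)
        then have "q x j = 0" by (simp add: q_def)
        with j pQ[OF True] show False by (simp add: set_pmf_iff)
      qed
    qed
  qed (use zX in \<open>simp add: Q_def\<close>)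
  have dec: "K x = bind_pmf (bernoulli_pmf \<beta>) (\<lambda>b. if b then return_pmf z else Q x)"
    if x: "x \<in> X" for x
  proof (rule pmf_eqI)
    fix j
    show "pmf (K x) j = pmf (bind_pmf (bernoulli_pmf \<beta>) (\<lambda>b. if b then return_pmf z else Q x)) j"
      using \<beta>0 \<beta>1 by (auto simp: pmf_bind pQ[OF x] q_def indicator_def)
  qed
  show ?thesis using that[OF \<beta>0 \<beta>1 setQ dec] by blast
qed

text \<open>Two copies of the chain stay coupled once they have been reset together, so their laws
  merge geometrically fast.\<close>

lemma doeblin_contraction:
  fixes g :: "'s \<Rightarrow> real"
  assumes \<beta>: "0 < \<beta>" "\<beta> < (1::real)" and Q: "\<And>x. set_pmf (Q x) \<subseteq> X"
    and K: "\<And>x. x \<in> X \<Longrightarrow>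
       K x = bind_pmf (bernoulli_pmf \<beta>) (\<lambda>b. if b then return_pmf z else Q x)"
    and g: "\<And>x. 0 \<le> g x" "\<And>x. g x \<le> 1"
    and d: "set_pmf d \<subseteq> X" "set_pmf d' \<subseteq> X"
  shows "\<bar>measure_pmf.expectation (evolve K n d) g - measure_pmf.expectation (evolve K n d') g\<bar>
           \<le> (1 - \<beta>) ^ n"
  using d
proof (induction n arbitrary: d d')
  case 0
  then show ?case
    using expectation_unit[of g d, OF g] expectation_unit[of g d', OF g] by (simp add: abs_le_iff)
next
  case (Suc n)
  have step: "measure_pmf.expectation (evolve K (Suc n) e) g
      = measure_pmf.expectation (evolve K n (return_pmf z)) g * \<beta>
        + measure_pmf.expectation (evolve K n (bind_pmf e Q)) g * (1 - \<beta>)"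
    if e: "set_pmf e \<subseteq> X" for e
  proof -
    have "bind_pmf e K = bind_pmf e (\<lambda>x. bind_pmf (bernoulli_pmf \<beta>) (\<lambda>b. if b then return_pmf z else Q x))"
      by (rule bind_pmf_cong) (use e K in auto)
    also have "\<dots> = bind_pmf (bernoulli_pmf \<beta>) (\<lambda>b. bind_pmf e (\<lambda>x. if b then return_pmf z else Q x))"
      by (rule bind_commute_pmf)
    also have "\<dots> = bind_pmf (bernoulli_pmf \<beta>) (\<lambda>b. if b then return_pmf z else bind_pmf e Q)"
      by (intro bind_pmf_cong) (auto cong: if_cong)
    finally show ?thesis using \<beta> by (simp add: evolve_bind expectation_bind_unit[OF g])
  qed
  have sub: "set_pmf (bind_pmf e Q) \<subseteq> X" for e using Q by auto
  have "\<bar>measure_pmf.expectation (evolve K (Suc n) d) g - measure_pmf.expectation (evolve K (Suc n) d') g\<bar>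
      = \<bar>measure_pmf.expectation (evolve K n (bind_pmf d Q)) g
         - measure_pmf.expectation (evolve K n (bind_pmf d' Q)) g\<bar> * (1 - \<beta>)"
    unfolding step[OF Suc.prems(1)] step[OF Suc.prems(2)] using \<beta> by (simp add: abs_mult flip: left_diff_distrib)
  also have "\<dots> \<le> (1 - \<beta>) ^ n * (1 - \<beta>)"
    by (rule mult_right_mono[OF Suc.IH[OF sub sub]]) (use \<beta> in simp)
  finally show ?case by (simp only: power_Suc2)
qed

text \<open>A stationary law is that of \<open>Q\<close> run from \<open>z\<close> for the geometrically distributed time that has
  passed since the last reset.\<close>

lemma doeblin_stationary_exists:
  assumes \<beta>: "0 < \<beta>" "\<beta> < (1::real)" and zX: "z \<in> X" and Q: "\<And>x. set_pmf (Q x) \<subseteq> X"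
    and K: "\<And>x. x \<in> X \<Longrightarrow>
       K x = bind_pmf (bernoulli_pmf \<beta>) (\<lambda>b. if b then return_pmf z else Q x)"
  shows "\<exists>d. set_pmf d \<subseteq> X \<and> bind_pmf d K = d"
proof -
  define d where "d = bind_pmf (geometric_pmf \<beta>) (\<lambda>n. evolve Q n (return_pmf z))"
  have setev: "set_pmf (evolve Q n e) \<subseteq> X" if "set_pmf e \<subseteq> X" for n e
    using that
  proof (induction n arbitrary: e)
    case (Suc n)
    have "set_pmf (bind_pmf e Q) \<subseteq> X" using Q by auto
    then show ?case using Suc.IH by simp
  qed simp
  have dX: "set_pmf d \<subseteq> X" unfolding d_def using setev[of "return_pmf z"] zX by auto
  have "d = bind_pmf (bernoulli_pmf \<beta>) (\<lambda>b. bind_pmf (if b then return_pmf 0 else map_pmf Suc (geometric_pmf \<beta>))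
      (\<lambda>n. evolve Q n (return_pmf z)))"
    unfolding d_def using \<beta> by (subst geometric_bind_pmf_unfold) (auto simp: bind_assoc_pmf)
  also have "\<dots> = bind_pmf (bernoulli_pmf \<beta>) (\<lambda>b. if b then return_pmf z else bind_pmf d Q)"
    by (intro bind_pmf_cong refl)
       (auto simp: bind_return_pmf bind_map_pmf d_def bind_assoc_pmf evolve_Suc_right simp del: evolve.simps(2))
  also have "\<dots> = bind_pmf (bernoulli_pmf \<beta>) (\<lambda>b. bind_pmf d (\<lambda>x. if b then return_pmf z else Q x))"
    by (intro bind_pmf_cong) auto
  also have "\<dots> = bind_pmf d (\<lambda>x. bind_pmf (bernoulli_pmf \<beta>) (\<lambda>b. if b then return_pmf z else Q x))"
    by (rule bind_commute_pmf)
  also have "\<dots> = bind_pmf d K"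
    by (rule bind_pmf_cong) (use dX K in auto)
  finally show ?thesis using dX by metis
qed

lemma doeblin:
  assumes fin: "finite X" and zX: "z \<in> X"
    and K: "\<And>x. x \<in> X \<Longrightarrow> set_pmf (K x) \<subseteq> X" "\<And>x. x \<in> X \<Longrightarrow> z \<in> set_pmf (K x)"
  shows stationary_dist: "set_pmf (stationary_dist X K) \<subseteq> X \<and>
            bind_pmf (stationary_dist X K) K = stationary_dist X K"
    and geometric_ergodicity: "\<exists>\<rho>. 0 \<le> \<rho> \<and> \<rho> < 1 \<and> (\<forall>x\<in>X. \<forall>n. \<forall>g :: 's \<Rightarrow> real.
            (\<forall>y. 0 \<le> g y \<and> g y \<le> 1) \<longrightarrow>
            \<bar>measure_pmf.expectation (evolve K n (return_pmf x)) g
              - measure_pmf.expectation (stationary_dist X K) g\<bar> \<le> \<rho> ^ n)"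
proof -
  obtain \<beta> Q where \<beta>: "0 < \<beta>" "\<beta> < (1::real)" and Q: "\<And>x. set_pmf (Q x) \<subseteq> X"
    and KQ: "\<And>x. x \<in> X \<Longrightarrow>
       K x = bind_pmf (bernoulli_pmf \<beta>) (\<lambda>b. if b then return_pmf z else Q x)"
    using doeblin_decomposition[where X=X and z=z and K=K, OF fin zX K] by metis
  note contr = doeblin_contraction[where X=X and Q=Q and K=K, OF \<beta> Q KQ]
  have uniq: "d = d'" if d: "set_pmf d \<subseteq> X" "bind_pmf d K = d"
    and d': "set_pmf d' \<subseteq> X" "bind_pmf d' K = d'" for d d'
  proof (rule pmf_eqI)
    fix j
    have le: "\<bar>pmf d j - pmf d' j\<bar> \<le> (1 - \<beta>) ^ n" for n
      using contr[where g = "indicator {j}" and n = n, OF _ _ _ d(1) d'(1)] d d'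
      by (simp add: evolve_stationary pmf.rep_eq)
    have "(\<lambda>n. (1 - \<beta>) ^ n) \<longlonglongrightarrow> 0" using \<beta> by (intro LIMSEQ_realpow_zero) auto
    then have "\<bar>pmf d j - pmf d' j\<bar> \<le> 0"
      by (rule LIMSEQ_le_const) (use le in auto)
    then show "pmf d j = pmf d' j" by simp
  qed
  obtain d where d: "set_pmf d \<subseteq> X" "bind_pmf d K = d"
    using doeblin_stationary_exists[where X=X and z=z and K=K and Q=Q, OF \<beta> zX Q KQ] by metis
  have "\<exists>!d. set_pmf d \<subseteq> X \<and> bind_pmf d K = d" using d uniq by blast
  then show st: "set_pmf (stationary_dist X K) \<subseteq> X \<and>
            bind_pmf (stationary_dist X K) K = stationary_dist X K"
    unfolding stationary_dist_def by (rule theI')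
  show "\<exists>\<rho>. 0 \<le> \<rho> \<and> \<rho> < 1 \<and> (\<forall>x\<in>X. \<forall>n. \<forall>g :: 's \<Rightarrow> real.
            (\<forall>y. 0 \<le> g y \<and> g y \<le> 1) \<longrightarrow>
            \<bar>measure_pmf.expectation (evolve K n (return_pmf x)) g
              - measure_pmf.expectation (stationary_dist X K) g\<bar> \<le> \<rho> ^ n)"
  proof (intro exI[of _ "1 - \<beta>"] conjI ballI allI impI)
    fix x n and g :: "'s \<Rightarrow> real"
    assume x: "x \<in> X" and g: "\<forall>y. 0 \<le> g y \<and> g y \<le> 1"
    show "\<bar>measure_pmf.expectation (evolve K n (return_pmf x)) g
              - measure_pmf.expectation (stationary_dist X K) g\<bar> \<le> (1 - \<beta>) ^ n"
      using contr[where g = g and n = n and d = "return_pmf x" and d' = "stationary_dist X K"] x g st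
      by (simp add: evolve_stationary)
  qed (use \<beta> in auto)
qed

section \<open>One entanglement buffer\<close>

lemma binomial_pmf_complement:
  assumes q: "0 \<le> q" "q \<le> 1"
  shows "map_pmf (\<lambda>k. n - k) (binomial_pmf n q) = binomial_pmf n (1 - q)"
proof (rule pmf_eqI)
  fix i
  show "pmf (map_pmf (\<lambda>k. n - k) (binomial_pmf n q)) i = pmf (binomial_pmf n (1 - q)) i"
  proof (cases "i \<le> n")
    case True
    have "pmf (map_pmf (\<lambda>k. n - k) (binomial_pmf n q)) i
        = measure_pmf.prob (binomial_pmf n q) ((\<lambda>k. n - k) -` {i})"
      by (simp add: pmf_map)
    also have "\<dots> = measure_pmf.prob (binomial_pmf n q) {n - i}"
      by (rule measure_prob_cong_0)
         (use True q in \<open>auto simp: binomial_eq_0_iff le_less_linear\<close>)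
    also have "\<dots> = pmf (binomial_pmf n q) (n - i)" by (simp add: pmf.rep_eq)
    finally show ?thesis using True q by (simp add: binomial_symmetric[symmetric] mult_ac)
  next
    case False
    then have "(\<lambda>k. n - k) -` {i} = {}" by auto
    then show ?thesis using False q by (simp add: pmf_map)
  qed
qed

text \<open>The law of the content of the buffer at \<open>v\<close> at the start of the next slot, when \<open>n\<close>
  entanglements are left after the service. Survivors are counted instead of losses, as in the
  reference chain. The switch, the reference chain and the request-agnostic chain differ at a
  single node only in the law of the number of entanglements consumed.\<close>

definition refill :: "('v, 'e) switch \<Rightarrow> 'v \<Rightarrow> nat \<Rightarrow> nat pmf" where
  "refill N v n = do {
     A \<leftarrow> bernoulli_pmf (lam N v);
     K \<leftarrow> binomial_pmf n (1 - mu N v);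
     return_pmf (min (buf N v) (K + of_bool A))
   }"

lemma refill_map:
  "refill N v n = bind_pmf (bernoulli_pmf (lam N v))
     (\<lambda>A. map_pmf (\<lambda>K. min (buf N v) (K + of_bool A)) (binomial_pmf n (1 - mu N v)))"
  unfolding refill_def map_pmf_def ..

lemma ref_step_refill:
  "ref_step N v i = bind_pmf (bernoulli_pmf (lam N v)) (\<lambda>S. refill N v (i - of_bool S))"
  unfolding ref_step_def refill_def ..

lemma mem_step_marginal:
  fixes N :: "('v::finite, 'e::finite) switch"
  assumes "valid_switch N"
  shows "map_pmf (\<lambda>L'. L' v) (mem_step N S L) = refill N v (L v - (\<Sum>e\<in>incident N v. S e))"
proof -
  let ?n = "\<lambda>v. L v - (\<Sum>e\<in>incident N v. S e)"
  let ?D = "Pi_pmf UNIV 0 (\<lambda>v. binomial_pmf (?n v) (mu N v))"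
  let ?Y = "Pi_pmf UNIV False (\<lambda>v. bernoulli_pmf (lam N v))"
  have mu: "0 \<le> mu N v" "mu N v \<le> 1"
    using assms by (auto simp: valid_switch_def less_imp_le)
  have D: "map_pmf (\<lambda>D. D v) ?D = binomial_pmf (?n v) (mu N v)"
    by (subst Pi_pmf_component) auto
  have Y: "map_pmf (\<lambda>Y. Y v) ?Y = bernoulli_pmf (lam N v)"
    by (subst Pi_pmf_component) auto
  have "map_pmf (\<lambda>L'. L' v) (mem_step N S L)
      = bind_pmf ?D (\<lambda>D. bind_pmf ?Y (\<lambda>Y. return_pmf (min (buf N v) (?n v - D v + of_bool (Y v)))))"
    by (simp add: mem_step_def map_bind_pmf)
  also have "\<dots> = bind_pmf (map_pmf (\<lambda>D. ?n v - D) (map_pmf (\<lambda>D. D v) ?D)) (\<lambda>K.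
      bind_pmf (map_pmf (\<lambda>Y. Y v) ?Y) (\<lambda>A. return_pmf (min (buf N v) (K + of_bool A))))"
    by (simp add: bind_map_pmf)
  also have "\<dots> = bind_pmf (binomial_pmf (?n v) (1 - mu N v)) (\<lambda>K.
      bind_pmf (bernoulli_pmf (lam N v)) (\<lambda>A. return_pmf (min (buf N v) (K + of_bool A))))"
    unfolding D Y binomial_pmf_complement[OF mu] ..
  also have "\<dots> = refill N v (?n v)"
    unfolding refill_def by (rule bind_commute_pmf)
  finally show ?thesis .
qed

lemma refill_le_buf: "set_pmf (refill N v n) \<subseteq> {0..buf N v}"
  by (auto simp: refill_def)

lemma zero_in_refill:
  assumes "valid_switch N"
  shows "0 \<in> set_pmf (refill N v n)"
proof -
  have "set_pmf (bernoulli_pmf (lam N v)) = UNIV" "set_pmf (binomial_pmf n (1 - mu N v)) = {..n}"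
    using assms by (auto simp: valid_switch_def)
  then have "0 \<in> (\<Union>A. \<Union>K\<le>n. {min (buf N v) (K + of_bool A)}) \<longleftrightarrow> 0 \<in> set_pmf (refill N v n)"
    by (simp add: refill_def)
  moreover have "(0::nat) \<in> {min (buf N v) (0 + of_bool False)}" by simp
  ultimately show ?thesis by blast
qed

lemma refill_mean_le:
  assumes "valid_switch N"
  shows "measure_pmf.expectation (refill N v n) real \<le> real n + lam N v"
proof -
  have lam: "0 \<le> lam N v" "lam N v \<le> 1" and mu: "0 < mu N v" "mu N v < 1"
    using assms by (auto simp: valid_switch_def less_imp_le)
  let ?K = "binomial_pmf n (1 - mu N v)"
  have K: "k \<le> n" if "k \<in> set_pmf ?K" for k using that mu by simp
  have fin: "finite (set_pmf (refill N v n))"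
    by (rule finite_subset[OF refill_le_buf]) simp
  have "measure_pmf.expectation (refill N v n) real
      = measure_pmf.expectation (bernoulli_pmf (lam N v)) (\<lambda>A.
          measure_pmf.expectation (map_pmf (\<lambda>K. min (buf N v) (K + of_bool A)) ?K) real)"
    using expectation_bind_pmf[OF integrable_measure_pmf_finite[OF fin, unfolded refill_map]]
    unfolding refill_map .
  also have "\<dots> \<le> measure_pmf.expectation (bernoulli_pmf (lam N v)) (\<lambda>A. real n + of_bool A)"
  proof (rule integral_pmf_mono)
    fix A
    have "measure_pmf.expectation (map_pmf (\<lambda>K. min (buf N v) (K + of_bool A)) ?K) real
        \<le> measure_pmf.expectation ?K (\<lambda>_. real n + of_bool A)"
      unfolding integral_map_pmf
      by (rule integral_pmf_mono) (use K mu in \<open>auto simp: min_def intro!: integrable_binomial_pmf\<close>)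
    then show "measure_pmf.expectation (map_pmf (\<lambda>K. min (buf N v) (K + of_bool A)) ?K) real
        \<le> real n + of_bool A" by simp
  qed (auto intro!: integrable_measure_pmf_finite)
  also have "\<dots> = real n + lam N v" using lam by (simp add: algebra_simps)
  finally show ?thesis .
qed

text \<open>More entanglements before decoherence give stochastically more in the next slot: the law of the
  survivors of \<open>Suc n\<close> entanglements is that of the survivors of \<open>n\<close> plus an independent
  Bernoulli variable.\<close>

lemma refill_mono:
  fixes f :: "nat \<Rightarrow> real"
  assumes "valid_switch N" and f: "mono f" "\<And>x. 0 \<le> f x" "\<And>x. f x \<le> 1" and "m \<le> n"
  shows "measure_pmf.expectation (refill N v m) f \<le> measure_pmf.expectation (refill N v n) f"
proof -
  have lam: "0 \<le> lam N v" "lam N v \<le> 1" and mu: "0 \<le> mu N v" "mu N v \<le> 1"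
    using assms(1) by (auto simp: valid_switch_def less_imp_le)
  let ?K = "\<lambda>n. binomial_pmf n (1 - mu N v)"
  have "measure_pmf.expectation (refill N v n) f \<le> measure_pmf.expectation (refill N v (Suc n)) f" for n
  proof -
    define g where "g A k = f (min (buf N v) (k + of_bool A))" for A k
    have g01: "0 \<le> g A k" "g A k \<le> 1" for A k using f by (auto simp: g_def)
    have eq: "measure_pmf.expectation (refill N v n) f
        = measure_pmf.expectation (bernoulli_pmf (lam N v)) (\<lambda>A. measure_pmf.expectation (?K n) (g A))" for n
      by (simp add: refill_map expectation_bind_unit[OF f(2,3)] g_def[abs_def])
    have inner: "measure_pmf.expectation (?K n) (g A) \<le> measure_pmf.expectation (?K (Suc n)) (g A)" for A
    proof -
      have "measure_pmf.expectation (?K (Suc n)) (g A)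
          = measure_pmf.expectation (bernoulli_pmf (1 - mu N v)) (\<lambda>b.
              measure_pmf.expectation (?K n) (\<lambda>k. g A ((if b then 1 else 0) + k)))"
        using mu by (simp add: binomial_pmf_Suc expectation_bind_unit[OF g01])
      also have "\<dots> \<ge> measure_pmf.expectation (bernoulli_pmf (1 - mu N v)) (\<lambda>b.
              measure_pmf.expectation (?K n) (g A))"
        by (intro integral_pmf_mono integrable_pmf_unit g01 expectation_unit)
           (auto simp: g_def intro!: monoD[OF f(1)])
      finally show ?thesis by simp
    qed
    show ?thesis unfolding eq
      by (intro integral_pmf_mono integrable_pmf_unit expectation_unit g01 inner)
  qed
  then show ?thesis using lift_Suc_mono_le[of "\<lambda>n. measure_pmf.expectation (refill N v n) f"] \<open>m \<le> n\<close>
    by blast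
qed

lemma mono_ref_step:
  fixes f :: "nat \<Rightarrow> real"
  assumes "valid_switch N" and f: "mono f" "\<And>x. 0 \<le> f x" "\<And>x. f x \<le> 1"
  shows "mono (\<lambda>i. measure_pmf.expectation (ref_step N v i) f)"
proof (rule monoI)
  fix i j :: nat
  assume "i \<le> j"
  show "measure_pmf.expectation (ref_step N v i) f \<le> measure_pmf.expectation (ref_step N v j) f"
    unfolding ref_step_refill expectation_bind_unit[OF f(2,3)]
    by (intro integral_pmf_mono integrable_pmf_unit expectation_unit f refill_mono assms(1))
       (use \<open>i \<le> j\<close> in auto)
qed

section \<open>Matchings and services\<close>

text \<open>The service indicator of the edge \<open>e\<close> when the matching \<open>M\<close> is chosen in the memory state
  \<open>L\<close>. The predicate \<open>P\<close> tells which edges have a pending request; it is constantly true for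
  request-agnostic policies.\<close>

definition served :: "('v, 'e) switch \<Rightarrow> 'e set \<Rightarrow> ('v \<Rightarrow> nat) \<Rightarrow> ('e \<Rightarrow> bool) \<Rightarrow> 'e \<Rightarrow> nat" where
  "served N M L P e = of_bool (e \<in> M \<and> P e \<and> L (end_u N e) > 0 \<and> L (end_v N e) > 0)"

lemma matching_incident:
  assumes "M \<in> matchings N" "e \<in> M" "f \<in> M" "e \<in> incident N v" "f \<in> incident N v"
  shows "e = f"
proof (rule ccontr)
  assume "e \<noteq> f"
  then have "{end_u N e, end_v N e} \<inter> {end_u N f, end_v N f} = {}"
    using assms unfolding matchings_def by blast
  then show False using assms(4,5) by (auto simp: incident_def)
qed

lemma served_at_node_le:
  fixes N :: "('v, 'e::finite) switch"
  assumes M: "M \<in> matchings N"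
  shows "(\<Sum>e\<in>incident N v. served N M L P e) \<le> of_bool (M \<inter> incident N v \<noteq> {})"
    and "(\<Sum>e\<in>incident N v. served N M L P e) \<le> L v"
proof -
  have "(\<Sum>e\<in>incident N v. served N M L P e) \<le> of_bool (M \<inter> incident N v \<noteq> {}) * min 1 (L v)"
  proof (cases "M \<inter> incident N v = {}")
    case True
    then have "(\<Sum>e\<in>incident N v. served N M L P e) = 0"
      by (intro sum.neutral) (auto simp: served_def)
    then show ?thesis by simp
  next
    case False
    then obtain e where e: "e \<in> M" "e \<in> incident N v" by auto
    have "(\<Sum>f\<in>incident N v. served N M L P f) = (\<Sum>f\<in>{e}. served N M L P f)"
      by (rule sum.mono_neutral_right)
         (use e matching_incident[OF M] in \<open>auto simp: served_def\<close>)
    also have "\<dots> = served N M L P e" by simp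
    also have "\<dots> \<le> min 1 (L v)" using e by (auto simp: served_def incident_def)
    finally show ?thesis using False by simp
  qed
  then show "(\<Sum>e\<in>incident N v. served N M L P e) \<le> of_bool (M \<inter> incident N v \<noteq> {})"
    "(\<Sum>e\<in>incident N v. served N M L P e) \<le> L v"
    by (cases "M \<inter> incident N v = {}"; simp)+
qed

text \<open>Each edge of a matching inside \<open>S\<close> uses two nodes of \<open>S\<close> that no other edge uses.\<close>

lemma matching_card_le:
  fixes N :: "('v::finite, 'e::finite) switch"
  assumes "valid_switch N" and M: "M \<in> matchings N"
  shows "2 * card (M \<inter> edges_in N S) \<le> card S"
proof -
  let ?A = "M \<inter> edges_in N S" and ?ends = "\<lambda>e. {end_u N e, end_v N e}"
  have "card (\<Union>e\<in>?A. ?ends e) = (\<Sum>e\<in>?A. card (?ends e))"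
    by (rule card_UN_disjoint) (use M in \<open>auto simp: matchings_def\<close>)
  also have "\<dots> = 2 * card ?A"
    using assms(1) by (simp add: valid_switch_def)
  finally have "2 * card ?A = card (\<Union>e\<in>?A. ?ends e)" by simp
  also have "\<dots> \<le> card S" by (rule card_mono) (auto simp: edges_in_def)
  finally show ?thesis .
qed

section \<open>Rates of request-agnostic policies are LP-feasible\<close>

lemma finite_mem_states: "finite (mem_states (N :: ('v::finite, 'e) switch))"
proof -
  have "mem_states N = PiE UNIV (\<lambda>v. {..buf N v})"
    by (auto simp: mem_states_def PiE_def Pi_def)
  then show ?thesis by (simp add: finite_PiE)
qed

lemma set_mem_step: "set_pmf (mem_step N S L) \<subseteq> mem_states N"
  by (auto simp: mem_step_def mem_states_def)

text \<open>The empty memory is reached in one step when every remaining entanglement is lost and none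
  arrives.\<close>

lemma empty_in_mem_step:
  assumes "valid_switch N"
  shows "(\<lambda>_. 0) \<in> set_pmf (mem_step N S L)"
proof -
  let ?n = "\<lambda>v. L v - (\<Sum>e\<in>incident N v. S e)"
  have D: "?n \<in> set_pmf (Pi_pmf UNIV 0 (\<lambda>v. binomial_pmf (?n v) (mu N v)))"
    using assms by (auto simp: set_Pi_pmf PiE_dflt_def valid_switch_def)
  have Y: "(\<lambda>_. False) \<in> set_pmf (Pi_pmf UNIV False (\<lambda>v. bernoulli_pmf (lam N v)))"
    using assms by (auto simp: set_Pi_pmf PiE_dflt_def valid_switch_def)
  have "(\<lambda>_. 0) = (\<lambda>v. min (buf N v) (?n v - ?n v + of_bool False))" by auto
  then show ?thesis using D Y unfolding mem_step_def set_bind_pmf set_return_pmf by blast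
qed

lemma agnostic_step_served:
  "agnostic_step N pol L = bind_pmf (pol L) (\<lambda>M. mem_step N (served N M L (\<lambda>_. True)) L)"
  by (simp add: agnostic_step_def served_def[abs_def])

text \<open>The long-run rate at which the policy serves the edge \<open>e\<close>. It is the expected number of
  services under the stationary law. Entanglements used at a node cannot outnumber the arrivals
  there, and each realised service vector is supported on a matching, so these rates satisfy
  the node constraints and the odd-set constraints.\<close>

definition agnostic_rate ::
    "('v::finite, 'e::finite) switch \<Rightarrow> (('v \<Rightarrow> nat) \<Rightarrow> 'e set pmf) \<Rightarrow> 'e \<Rightarrow> real" where
  "agnostic_rate N pol e =
     measure_pmf.expectation (stationary_dist (mem_states N) (agnostic_step N pol)) (\<lambda>L.
       measure_pmf.expectation (pol L) (\<lambda>M. real (served N M L (\<lambda>_. True) e)))"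

context
  fixes N :: "('v::finite, 'e::finite) switch" and pol :: "('v \<Rightarrow> nat) \<Rightarrow> 'e set pmf"
  assumes valid: "valid_switch N"
    and pol: "\<And>L. L \<in> mem_states N \<Longrightarrow> set_pmf (pol L) \<subseteq> matchings N"
begin

private abbreviation (input) "d \<equiv> stationary_dist (mem_states N) (agnostic_step N pol)"

lemma agnostic_stationary:
  shows "set_pmf d \<subseteq> mem_states N" "bind_pmf d (agnostic_step N pol) = d"
proof -
  have "set_pmf d \<subseteq> mem_states N \<and> bind_pmf d (agnostic_step N pol) = d"
  proof (rule stationary_dist[OF finite_mem_states, where z = "\<lambda>_. 0"])
    show "(\<lambda>_. 0) \<in> mem_states N" by (simp add: mem_states_def)
    show "set_pmf (agnostic_step N pol L) \<subseteq> mem_states N" for L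
      using set_mem_step by (auto simp: agnostic_step_served)
    show "(\<lambda>_. 0) \<in> set_pmf (agnostic_step N pol L)" for L
      using empty_in_mem_step[OF valid] set_pmf_not_empty[of "pol L"]
      by (auto simp: agnostic_step_served)
  qed
  then show "set_pmf d \<subseteq> mem_states N" "bind_pmf d (agnostic_step N pol) = d" by auto
qed

lemma finite_agnostic: "finite (set_pmf d)"
  using agnostic_stationary(1) finite_mem_states by (rule finite_subset)

lemma agnostic_rate_eq:
  "agnostic_rate N pol e =
     (\<Sum>L\<in>{L \<in> mem_states N. L (end_u N e) > 0 \<and> L (end_v N e) > 0}.
        \<Sum>M\<in>{M \<in> matchings N. e \<in> M}. pmf (pol L) M * pmf d L)"
proof -
  let ?A = "{L \<in> mem_states N. L (end_u N e) > 0 \<and> L (end_v N e) > 0}"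
  let ?F = "\<lambda>L. measure_pmf.expectation (pol L) (\<lambda>M. real (served N M L (\<lambda>_. True) e))"
  have F: "?F L = (\<Sum>M\<in>{M \<in> matchings N. e \<in> M}. pmf (pol L) M)" if "L \<in> ?A" for L
  proof -
    have "?F L = (\<Sum>M\<in>{M \<in> matchings N. e \<in> M}. real (served N M L (\<lambda>_. True) e) * pmf (pol L) M)"
      by (rule integral_measure_pmf_real) (use that pol[of L] in \<open>auto simp: served_def\<close>)
    also have "\<dots> = (\<Sum>M\<in>{M \<in> matchings N. e \<in> M}. pmf (pol L) M)"
      by (rule sum.cong) (use that in \<open>auto simp: served_def\<close>)
    finally show ?thesis .
  qed
  have "agnostic_rate N pol e = (\<Sum>L\<in>?A. ?F L * pmf d L)"
    unfolding agnostic_rate_def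
  proof (rule integral_measure_pmf_real)
    show "finite ?A" by (rule finite_subset[OF _ finite_mem_states[of N]]) auto
    fix L assume L: "L \<in> set_pmf d" "?F L \<noteq> 0"
    have "L (end_u N e) > 0 \<and> L (end_v N e) > 0"
    proof (rule ccontr)
      assume "\<not> ?thesis"
      then have "served N M L (\<lambda>_. True) e = 0" for M by (auto simp: served_def)
      then show False using L(2) by simp
    qed
    then show "L \<in> ?A" using agnostic_stationary(1) L(1) by auto
  qed
  also have "\<dots> = (\<Sum>L\<in>?A. (\<Sum>M\<in>{M \<in> matchings N. e \<in> M}. pmf (pol L) M * pmf d L))"
    by (rule sum.cong[OF refl]) (simp only: F sum_distrib_right)
  finally show ?thesis .
qed

lemma sum_agnostic_rate:
  "(\<Sum>e\<in>E. agnostic_rate N pol e) =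
     measure_pmf.expectation d (\<lambda>L.
       measure_pmf.expectation (pol L) (\<lambda>M. real (\<Sum>e\<in>E. served N M L (\<lambda>_. True) e)))"
  unfolding agnostic_rate_def of_nat_sum
  by (simp add: integral_sum integrable_measure_pmf_finite finite_agnostic)

text \<open>In the stationary regime the mean content of the buffer at \<open>v\<close> does not change. A slot adds at
  most \<open>lam N v\<close> on average and removes at least the entanglements consumed by services.\<close>

lemma agnostic_rate_node: "(\<Sum>e\<in>incident N v. agnostic_rate N pol e) \<le> lam N v"
proof -
  let ?s = "\<lambda>M L. \<Sum>e\<in>incident N v. served N M L (\<lambda>_. True) e"
  have next_mean: "measure_pmf.expectation (agnostic_step N pol L) (\<lambda>L'. real (L' v))
      \<le> real (L v) + lam N v - measure_pmf.expectation (pol L) (\<lambda>M. real (?s M L))"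
    if L: "L \<in> mem_states N" for L
  proof -
    have fin: "finite (set_pmf (agnostic_step N pol L))"
      by (rule finite_subset[OF _ finite_mem_states[of N]])
         (use set_mem_step in \<open>auto simp: agnostic_step_served\<close>)
    have "measure_pmf.expectation (agnostic_step N pol L) (\<lambda>L'. real (L' v))
        = measure_pmf.expectation (pol L) (\<lambda>M.
            measure_pmf.expectation (mem_step N (served N M L (\<lambda>_. True)) L) (\<lambda>L'. real (L' v)))"
      unfolding agnostic_step_served
      by (rule expectation_bind_pmf)
         (use integrable_measure_pmf_finite[OF fin] in \<open>simp add: agnostic_step_served\<close>)
    also have "\<dots> \<le> measure_pmf.expectation (pol L) (\<lambda>M. real (L v) + lam N v - real (?s M L))"
    proof (rule integral_pmf_mono)
      fix M assume "M \<in> set_pmf (pol L)"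
      then have M: "M \<in> matchings N" using pol[OF L] by auto
      have "measure_pmf.expectation (mem_step N (served N M L (\<lambda>_. True)) L) (\<lambda>L'. real (L' v))
          = measure_pmf.expectation (map_pmf (\<lambda>L'. L' v) (mem_step N (served N M L (\<lambda>_. True)) L)) real"
        by simp
      also have "\<dots> = measure_pmf.expectation (refill N v (L v - ?s M L)) real"
        unfolding mem_step_marginal[OF valid] ..
      also have "\<dots> \<le> real (L v - ?s M L) + lam N v" by (rule refill_mean_le[OF valid])
      also have "real (L v - ?s M L) = real (L v) - real (?s M L)"
        by (rule of_nat_diff) (rule served_at_node_le(2)[OF M])
      finally show "measure_pmf.expectation (mem_step N (served N M L (\<lambda>_. True)) L) (\<lambda>L'. real (L' v))
          \<le> real (L v) + lam N v - real (?s M L)" by linarith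
    qed (simp_all add: integrable_measure_pmf_finite)
    also have "\<dots> = real (L v) + lam N v - measure_pmf.expectation (pol L) (\<lambda>M. real (?s M L))"
      by (simp add: integrable_measure_pmf_finite)
    finally show ?thesis .
  qed
  have "measure_pmf.expectation d (\<lambda>L. real (L v))
      = measure_pmf.expectation (bind_pmf d (agnostic_step N pol)) (\<lambda>L. real (L v))"
    by (simp only: agnostic_stationary(2))
  also have "\<dots> = measure_pmf.expectation d (\<lambda>L.
        measure_pmf.expectation (agnostic_step N pol L) (\<lambda>L'. real (L' v)))"
    by (rule expectation_bind_pmf)
       (simp only: agnostic_stationary(2) integrable_measure_pmf_finite finite_agnostic)
  also have "\<dots> \<le> measure_pmf.expectation d (\<lambda>L.
        real (L v) + lam N v - measure_pmf.expectation (pol L) (\<lambda>M. real (?s M L)))"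
    by (rule integral_pmf_mono)
       (use next_mean agnostic_stationary(1) in \<open>auto simp: integrable_measure_pmf_finite finite_agnostic\<close>)
  also have "\<dots> = measure_pmf.expectation d (\<lambda>L. real (L v)) + lam N v
        - (\<Sum>e\<in>incident N v. agnostic_rate N pol e)"
    unfolding sum_agnostic_rate by (simp add: integrable_measure_pmf_finite finite_agnostic del: of_nat_sum)
  finally show ?thesis by simp
qed

lemma agnostic_rate_odd_set:
  assumes "odd (card S)"
  shows "(\<Sum>e\<in>edges_in N S. agnostic_rate N pol e) \<le> (real (card S) - 1) / 2"
proof -
  let ?s = "\<lambda>M L. \<Sum>e\<in>edges_in N S. served N M L (\<lambda>_. True) e"
  have s: "real (?s M L) \<le> (real (card S) - 1) / 2" if M: "M \<in> matchings N" for M L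
  proof -
    have "?s M L \<le> (\<Sum>e\<in>edges_in N S. of_bool (e \<in> M))"
      by (rule sum_mono) (simp add: served_def)
    also have "\<dots> = card (M \<inter> edges_in N S)" by (simp add: Int_commute)
    finally have "2 * ?s M L \<le> card S" using matching_card_le[OF valid M, of S] by linarith
    \<comment> \<open>Parity improves the bound \<open>card S / 2\<close> by one half.\<close>
    moreover have "2 * ?s M L \<noteq> card S" using assms by (metis dvd_triv_left)
    ultimately have "2 * ?s M L + 1 \<le> card S" by linarith
    then have "real (2 * ?s M L + 1) \<le> real (card S)" by (simp only: of_nat_le_iff)
    then show ?thesis by simp
  qed
  have "(\<Sum>e\<in>edges_in N S. agnostic_rate N pol e)
      \<le> measure_pmf.expectation d (\<lambda>L. (real (card S) - 1) / 2)"
    unfolding sum_agnostic_rate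
  proof (rule integral_pmf_mono)
    fix L assume "L \<in> set_pmf d"
    then have L: "L \<in> mem_states N" using agnostic_stationary(1) by auto
    have "measure_pmf.expectation (pol L) (\<lambda>M. real (?s M L))
        \<le> measure_pmf.expectation (pol L) (\<lambda>M. (real (card S) - 1) / 2)"
      by (rule integral_pmf_mono) (use s pol[OF L] in \<open>auto simp: integrable_measure_pmf_finite simp del: of_nat_sum\<close>)
    then show "measure_pmf.expectation (pol L) (\<lambda>M. real (?s M L)) \<le> (real (card S) - 1) / 2" by simp
  qed (simp_all add: integrable_measure_pmf_finite finite_agnostic del: of_nat_sum)
  then show ?thesis by simp
qed

lemma agnostic_rate_feasible: "lp_feasible N (agnostic_rate N pol)"
  unfolding lp_feasible_def
proof (intro conjI allI impI)
  show "0 \<le> agnostic_rate N pol e" for e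
    unfolding agnostic_rate_def by (intro Bochner_Integration.integral_nonneg) simp
qed (use agnostic_rate_node agnostic_rate_odd_set in auto)

end

lemma capacity_region_dominated:
  assumes "valid_switch N" "\<nu> \<in> capacity_region N"
  obtains r where "lp_feasible N r" "\<And>e. \<nu> e < r e"
proof -
  obtain pol where pol: "\<And>L. L \<in> mem_states N \<Longrightarrow> set_pmf (pol L) \<subseteq> matchings N"
    and less: "\<And>e. \<nu> e < (\<Sum>L\<in>{L \<in> mem_states N. L (end_u N e) > 0 \<and> L (end_v N e) > 0}.
              \<Sum>M\<in>{M \<in> matchings N. e \<in> M}.
                pmf (pol L) M * pmf (stationary_dist (mem_states N) (agnostic_step N pol)) L)"
    using assms(2) unfolding capacity_region_def by blast
  have "\<nu> e < agnostic_rate N pol e" for e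
    using less[of e] by (subst agnostic_rate_eq[OF assms(1)]) (rule pol)
  moreover have "lp_feasible N (agnostic_rate N pol)"
    by (rule agnostic_rate_feasible[OF assms(1)]) (rule pol)
  ultimately show ?thesis using that by blast
qed

section \<open>Availability of entanglements within a frame\<close>

text \<open>The indicator of a nonempty buffer. It is real-valued and monotone, so that the comparison of
  monotone functionals applies to it.\<close>

definition nonempty :: "nat \<Rightarrow> real" where
  "nonempty i = of_bool (0 < i)"

lemma nonempty_props: "mono nonempty" "\<And>i. 0 \<le> nonempty i" "\<And>i. nonempty i \<le> 1"
  by (auto simp: nonempty_def mono_def)

text \<open>The probability that the reference chain of node \<open>v\<close>, started with an empty buffer, has an
  entanglement at time \<open>t\<close>.\<close>

definition ref_available :: "('v, 'e) switch \<Rightarrow> 'v \<Rightarrow> nat \<Rightarrow> real" where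
  "ref_available N v t = measure_pmf.expectation (evolve (ref_step N v) t (return_pmf 0)) nonempty"

text \<open>Since the reference chain converges geometrically, its availability summed over a frame falls
  short of \<open>T\<close> times the stationary availability by at most a constant that is independent of
  \<open>T\<close>.\<close>

lemma sum_ref_available_ge:
  assumes "valid_switch N"
  obtains c where "0 \<le> c" "\<And>T. real T * availability N v - c \<le> (\<Sum>t<T. ref_available N v t)"
proof -
  let ?\<pi> = "stationary_dist {0..buf N v} (ref_step N v)"
  have lam: "0 < lam N v" "lam N v < 1" using assms by (auto simp: valid_switch_def)
  obtain \<rho> where \<rho>: "0 \<le> \<rho>" "\<rho> < 1"
    and erg: "\<forall>x\<in>{0..buf N v}. \<forall>n. \<forall>g :: nat \<Rightarrow> real. (\<forall>y. 0 \<le> g y \<and> g y \<le> 1) \<longrightarrow>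
        \<bar>measure_pmf.expectation (evolve (ref_step N v) n (return_pmf x)) g
          - measure_pmf.expectation ?\<pi> g\<bar> \<le> \<rho> ^ n"
  proof -
    have sub: "set_pmf (ref_step N v i) \<subseteq> {0..buf N v}" for i
      unfolding ref_step_refill set_bind_pmf using refill_le_buf[of N v] by blast
    have zero: "0 \<in> set_pmf (ref_step N v i)" for i
      unfolding ref_step_refill set_bind_pmf using lam zero_in_refill[OF assms, of v] by auto
    show thesis
      using geometric_ergodicity[of "{0..buf N v}" 0 "ref_step N v"] sub zero that by auto
  qed
  have "measure_pmf.expectation ?\<pi> nonempty = measure_pmf.expectation ?\<pi> (\<lambda>i. 1 - indicator {0} i)"
    by (rule Bochner_Integration.integral_cong) (auto simp: nonempty_def indicator_def)
  also have "\<dots> = availability N v"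
    by (subst Bochner_Integration.integral_diff)
       (auto simp: availability_def pmf.rep_eq intro!: integrable_pmf_unit)
  finally have lim: "measure_pmf.expectation ?\<pi> nonempty = availability N v" .
  have le: "availability N v - \<rho> ^ t \<le> ref_available N v t" for t
    using erg[rule_format, of 0 nonempty t] nonempty_props(2,3)
    by (simp add: lim ref_available_def abs_le_iff)
  show thesis
  proof (rule that)
    show "0 \<le> 1 / (1 - \<rho>)" using \<rho> by simp
    fix T
    have "(\<Sum>t<T. \<rho> ^ t) = (1 - \<rho> ^ T) / (1 - \<rho>)"
      using \<rho> by (simp add: sum_gp_strict)
    also have "\<dots> \<le> 1 / (1 - \<rho>)" using \<rho> by (simp add: divide_right_mono)
    finally have "real T * availability N v - 1 / (1 - \<rho>) \<le> (\<Sum>t<T. availability N v - \<rho> ^ t)"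
      by (simp add: sum_subtractf)
    also have "\<dots> \<le> (\<Sum>t<T. ref_available N v t)" by (rule sum_mono) (rule le)
    finally show "real T * availability N v - 1 / (1 - \<rho>) \<le> (\<Sum>t<T. ref_available N v t)" .
  qed
qed

lemma switch_step_served:
  "switch_step N arr p (L, R) = bind_pmf p (\<lambda>M.
     bind_pmf (mem_step N (served N M L (\<lambda>e. 0 < R e)) L) (\<lambda>L'.
       map_pmf (\<lambda>A. (L', \<lambda>e. R e - served N M L (\<lambda>e. 0 < R e) e + A e)) arr))"
  by (simp add: switch_step_def served_def[abs_def] map_pmf_def)

lemma switch_step_memory:
  fixes N :: "('v::finite, 'e::finite) switch"
  assumes "valid_switch N"
  shows "map_pmf (\<lambda>s. fst s v) (switch_step N arr p (L, R)) =
     bind_pmf p (\<lambda>M. refill N v (L v - (\<Sum>e\<in>incident N v. served N M L (\<lambda>e. 0 < R e) e)))"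
  by (simp add: switch_step_served map_bind_pmf pmf.map_comp o_def map_pmf_const
        mem_step_marginal[OF assms, symmetric] flip: map_pmf_def)

lemma switch_step_queue:
  "map_pmf (\<lambda>s. snd s e) (switch_step N arr p (L, R)) =
     bind_pmf p (\<lambda>M. map_pmf (\<lambda>A. R e - served N M L (\<lambda>e. 0 < R e) e + A e) arr)"
  by (simp add: switch_step_served map_bind_pmf pmf.map_comp o_def)

text \<open>Below, \<open>p\<close> is the law of the matching within a frame, and \<open>x e\<close> is the probability that it
  contains the edge \<open>e\<close>. Of the LP only the node constraints on \<open>x\<close> matter for the dynamics.\<close>

context
  fixes N :: "('v::finite, 'e::finite) switch" and arr :: "('e \<Rightarrow> nat) pmf"
    and p :: "'e set pmf" and x :: "'e \<Rightarrow> real"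
  assumes valid: "valid_switch N"
    and p: "set_pmf p \<subseteq> matchings N"
    and x: "\<And>e. measure_pmf.expectation p (\<lambda>M. of_bool (e \<in> M)) = x e"
    and node: "\<And>v. (\<Sum>e\<in>incident N v. x e) \<le> lam N v"
begin

lemma scheduled_at_node_le:
  "measure_pmf.expectation p (\<lambda>M. of_bool (M \<inter> incident N v \<noteq> {})) \<le> lam N v"
proof -
  have "measure_pmf.expectation p (\<lambda>M. of_bool (M \<inter> incident N v \<noteq> {}))
      \<le> measure_pmf.expectation p (\<lambda>M. \<Sum>e\<in>incident N v. of_bool (e \<in> M) :: real)"
  proof (rule integral_pmf_mono)
    fix M
    have "of_bool (e \<in> M) \<le> (\<Sum>e\<in>incident N v. of_bool (e \<in> M) :: real)" if "e \<in> incident N v" for e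
      using that by (intro member_le_sum) auto
    then show "of_bool (M \<inter> incident N v \<noteq> {}) \<le> (\<Sum>e\<in>incident N v. of_bool (e \<in> M) :: real)"
      by (cases "M \<inter> incident N v = {}") (force intro: sum_nonneg)+
  qed (auto intro!: integrable_measure_pmf_finite)
  also have "\<dots> = (\<Sum>e\<in>incident N v. x e)"
    by (simp add: integral_sum integrable_measure_pmf_finite x del: sum_of_bool_eq)
  finally show ?thesis using node[of v] by simp
qed

text \<open>In one slot the buffer at \<open>v\<close> stochastically dominates the reference chain: a service at \<open>v\<close>
  requires that the matching covers \<open>v\<close>, and this has probability at most \<open>lam N v\<close>.\<close>

lemma switch_step_dominates:
  fixes f :: "nat \<Rightarrow> real"
  assumes f: "mono f" "\<And>i. 0 \<le> f i" "\<And>i. f i \<le> 1"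
  shows "measure_pmf.expectation (ref_step N v (fst s v)) f
       \<le> measure_pmf.expectation (switch_step N arr p s) (\<lambda>s'. f (fst s' v))"
proof (cases s)
  case (Pair L R)
  define h where "h n = measure_pmf.expectation (refill N v n) f" for n
  have h: "mono h"
    by (rule monoI) (simp add: h_def refill_mono[OF valid f])
  let ?a = "measure_pmf.expectation p (\<lambda>M. of_bool (M \<inter> incident N v \<noteq> {}) :: real)"
  have "measure_pmf.expectation (ref_step N v (L v)) f = h (L v - 1) * lam N v + h (L v) * (1 - lam N v)"
    using valid by (simp add: ref_step_refill expectation_bind_unit[OF f(2,3)] valid_switch_def less_imp_le h_def)
  also have "\<dots> = h (L v) - lam N v * (h (L v) - h (L v - 1))" by (simp add: algebra_simps)
  also have "\<dots> \<le> h (L v) - ?a * (h (L v) - h (L v - 1))"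
    using mult_right_mono[OF scheduled_at_node_le[of v], of "h (L v) - h (L v - 1)"] monoD[OF h, of "L v - 1" "L v"]
    by simp
  also have "\<dots> = measure_pmf.expectation p (\<lambda>M.
        h (L v) - of_bool (M \<inter> incident N v \<noteq> {}) * (h (L v) - h (L v - 1)))"
    by (simp add: integrable_measure_pmf_finite)
  also have "\<dots> \<le> measure_pmf.expectation p (\<lambda>M.
        h (L v - (\<Sum>e\<in>incident N v. served N M L (\<lambda>e. 0 < R e) e)))"
  proof (rule integral_pmf_mono)
    fix M assume "M \<in> set_pmf p"
    then have M: "M \<in> matchings N" using p by auto
    let ?s = "\<Sum>e\<in>incident N v. served N M L (\<lambda>e. 0 < R e) e"
    have "h (L v) - of_bool (M \<inter> incident N v \<noteq> {}) * (h (L v) - h (L v - 1))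
        = h (L v - of_bool (M \<inter> incident N v \<noteq> {}))" by simp
    also have "\<dots> \<le> h (L v - ?s)"
      by (rule monoD[OF h], rule diff_le_mono2) (rule served_at_node_le(1)[OF M])
    finally show "h (L v) - of_bool (M \<inter> incident N v \<noteq> {}) * (h (L v) - h (L v - 1)) \<le> h (L v - ?s)" .
  qed (simp_all add: integrable_measure_pmf_finite)
  also have "\<dots> = measure_pmf.expectation (map_pmf (\<lambda>s. fst s v) (switch_step N arr p (L, R))) f"
    unfolding switch_step_memory[OF valid] h_def by (rule expectation_bind_unit[OF f(2,3), symmetric])
  also have "\<dots> = measure_pmf.expectation (switch_step N arr p s) (\<lambda>s'. f (fst s' v))"
    by (simp add: Pair)
  finally show ?thesis by (simp add: Pair)
qed

text \<open>Iterating the comparison uses that the reference kernel maps monotone functions to monotone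
  functions.\<close>

lemma evolve_dominates:
  fixes f :: "nat \<Rightarrow> real"
  assumes "mono f" "\<And>i. 0 \<le> f i" "\<And>i. f i \<le> 1" and i: "i \<le> fst s v"
  shows "measure_pmf.expectation (evolve (ref_step N v) t (return_pmf i)) f
       \<le> measure_pmf.expectation (evolve (switch_step N arr p) t (return_pmf s)) (\<lambda>s'. f (fst s' v))"
  using assms(1-3)
proof (induction t arbitrary: f)
  case 0
  then show ?case using i by (simp add: monoD)
next
  case (Suc t)
  note f = Suc.prems
  define g where "g j = measure_pmf.expectation (ref_step N v j) f" for j
  have g01: "0 \<le> g j" "g j \<le> 1" for j
    using expectation_unit[of f, OF f(2,3)] by (auto simp: g_def)
  have g: "mono g" unfolding g_def by (rule mono_ref_step[OF valid f])
  have "measure_pmf.expectation (evolve (ref_step N v) (Suc t) (return_pmf i)) f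
      = measure_pmf.expectation (evolve (ref_step N v) t (return_pmf i)) g"
    unfolding evolve_Suc_right g_def[abs_def] by (rule expectation_bind_unit[OF f(2,3)])
  also have "\<dots> \<le> measure_pmf.expectation (evolve (switch_step N arr p) t (return_pmf s)) (\<lambda>s'. g (fst s' v))"
    by (rule Suc.IH[OF g g01])
  also have "\<dots> \<le> measure_pmf.expectation (evolve (switch_step N arr p) t (return_pmf s)) (\<lambda>s'.
      measure_pmf.expectation (switch_step N arr p s') (\<lambda>s'. f (fst s' v)))"
    unfolding g_def
    by (intro integral_pmf_mono integrable_pmf_unit expectation_unit f switch_step_dominates)
  also have "\<dots> = measure_pmf.expectation (evolve (switch_step N arr p) (Suc t) (return_pmf s)) (\<lambda>s'. f (fst s' v))"
    unfolding evolve_Suc_right by (rule expectation_bind_unit[symmetric]) (use f in auto)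
  finally show ?case .
qed

text \<open>The buffers at the two ends of an edge are dependent, whence the union bound.\<close>

lemma edge_available_ge:
  "ref_available N (end_u N e) t + ref_available N (end_v N e) t - 1
     \<le> measure_pmf.expectation (evolve (switch_step N arr p) t (return_pmf s))
          (\<lambda>s'. of_bool (0 < fst s' (end_u N e) \<and> 0 < fst s' (end_v N e)))"
proof -
  let ?P = "evolve (switch_step N arr p) t (return_pmf s)"
  have dom: "ref_available N v t \<le> measure_pmf.expectation ?P (\<lambda>s'. nonempty (fst s' v))" for v
    unfolding ref_available_def by (rule evolve_dominates[OF nonempty_props]) simp
  have int: "integrable ?P (\<lambda>s'. nonempty (fst s' v))" for v
    by (rule integrable_pmf_unit) (simp_all add: nonempty_props)
  have "measure_pmf.expectation ?P (\<lambda>s'. nonempty (fst s' (end_u N e)) + nonempty (fst s' (end_v N e)) - 1)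
      \<le> measure_pmf.expectation ?P (\<lambda>s'. of_bool (0 < fst s' (end_u N e) \<and> 0 < fst s' (end_v N e)))"
    by (rule integral_pmf_mono) (auto simp: int nonempty_def intro!: integrable_pmf_unit Bochner_Integration.integrable_diff Bochner_Integration.integrable_add)
  then show ?thesis using dom[of "end_u N e"] dom[of "end_v N e"] by (simp add: int)
qed

end

section \<open>Queue increments over a frame\<close>

lemma integrable_pmf_if_square:
  fixes h :: "'a \<Rightarrow> real"
  assumes "integrable (measure_pmf q) (\<lambda>x. (h x)\<^sup>2)"
  shows "integrable (measure_pmf q) h"
proof (rule Bochner_Integration.integrable_bound)
  show "integrable (measure_pmf q) (\<lambda>x. 1 + (h x)\<^sup>2)" using assms by simp
  show "AE x in measure_pmf q. norm (h x) \<le> norm (1 + (h x)\<^sup>2)"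
  proof (rule AE_I2)
    fix x
    have "0 \<le> (\<bar>h x\<bar> - 1)\<^sup>2" by simp
    then have "2 * \<bar>h x\<bar> \<le> 1 + (h x)\<^sup>2" by (simp add: power2_diff)
    then show "norm (h x) \<le> norm (1 + (h x)\<^sup>2)" by simp
  qed
qed simp

lemma request_arrivals_integrable:
  assumes "request_arrivals arr \<nu> \<sigma>"
  shows "integrable (measure_pmf arr) (\<lambda>A. (real (A e) + 1)\<^sup>2)"
proof -
  have "integrable (measure_pmf arr) (\<lambda>A. (real (A e) - \<nu> e)\<^sup>2 + 2 * (\<nu> e + 1) * real (A e) + (1 - (\<nu> e)\<^sup>2))"
    using assms unfolding request_arrivals_def
    by (intro Bochner_Integration.integrable_add integrable_mult_right) auto
  also have "(\<lambda>A. (real (A e) - \<nu> e)\<^sup>2 + 2 * (\<nu> e + 1) * real (A e) + (1 - (\<nu> e)\<^sup>2)) = (\<lambda>A :: 'a \<Rightarrow> nat. (real (A e) + 1)\<^sup>2)"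
    by (rule ext) (simp add: power2_eq_square algebra_simps)
  finally show ?thesis .
qed

context
  fixes N :: "('v::finite, 'e::finite) switch" and arr :: "('e \<Rightarrow> nat) pmf" and \<nu> \<sigma> :: "'e \<Rightarrow> real"
    and p :: "'e set pmf" and x :: "'e \<Rightarrow> real"
  assumes valid: "valid_switch N"
    and arr: "request_arrivals arr \<nu> \<sigma>"
    and p: "set_pmf p \<subseteq> matchings N"
    and x: "\<And>e. measure_pmf.expectation p (\<lambda>M. of_bool (e \<in> M)) = x e"
    and node: "\<And>v. (\<Sum>e\<in>incident N v. x e) \<le> lam N v"
begin

private abbreviation "chain t s \<equiv> evolve (switch_step N arr p) t (return_pmf s)"

lemma switch_step_queue_square:
  "(\<integral>\<^sup>+s'. ennreal ((real (snd s' e) - b)\<^sup>2) \<partial>measure_pmf (switch_step N arr p s))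
     \<le> ennreal (2 * (real (snd s e) - b)\<^sup>2
                  + 2 * measure_pmf.expectation arr (\<lambda>A. (real (A e) + 1)\<^sup>2))"
proof (cases s)
  case (Pair L R)
  let ?m = "measure_pmf.expectation arr (\<lambda>A. (real (A e) + 1)\<^sup>2)"
  have inner: "(\<integral>\<^sup>+A. ennreal ((real (R e - served N M L (\<lambda>e. 0 < R e) e + A e) - b)\<^sup>2) \<partial>measure_pmf arr)
      \<le> ennreal (2 * (real (R e) - b)\<^sup>2 + 2 * ?m)" for M
  proof -
    have pt: "(real (R e - served N M L (\<lambda>e. 0 < R e) e + A e) - b)\<^sup>2
        \<le> 2 * (real (R e) - b)\<^sup>2 + 2 * (real (A e) + 1)\<^sup>2" for A
    proof -
      define y where "y = real (R e - served N M L (\<lambda>e. 0 < R e) e + A e) - real (R e)"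
      have "\<bar>y\<bar> \<le> real (A e) + 1" unfolding y_def by (auto simp: served_def)
      then have "y\<^sup>2 \<le> (real (A e) + 1)\<^sup>2" by (metis abs_ge_zero power2_abs power_mono)
      moreover have "((real (R e) - b) + y)\<^sup>2 \<le> 2 * (real (R e) - b)\<^sup>2 + 2 * y\<^sup>2"
        using sum_squares_bound[of "real (R e) - b" y] by (simp add: power2_sum)
      ultimately show ?thesis by (simp add: y_def)
    qed
    have "(\<integral>\<^sup>+A. ennreal ((real (R e - served N M L (\<lambda>e. 0 < R e) e + A e) - b)\<^sup>2) \<partial>measure_pmf arr)
        \<le> (\<integral>\<^sup>+A. ennreal (2 * (real (R e) - b)\<^sup>2 + 2 * (real (A e) + 1)\<^sup>2) \<partial>measure_pmf arr)"
      by (intro nn_integral_mono ennreal_leI pt)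
    also have "\<dots> = ennreal (measure_pmf.expectation arr (\<lambda>A. 2 * (real (R e) - b)\<^sup>2 + 2 * (real (A e) + 1)\<^sup>2))"
      by (rule nn_integral_eq_integral) (auto simp: request_arrivals_integrable[OF arr])
    also have "\<dots> = ennreal (2 * (real (R e) - b)\<^sup>2 + 2 * ?m)"
      by (simp add: request_arrivals_integrable[OF arr])
    finally show ?thesis .
  qed
  have "(\<integral>\<^sup>+s'. ennreal ((real (snd s' e) - b)\<^sup>2) \<partial>measure_pmf (switch_step N arr p s))
      = (\<integral>\<^sup>+r. ennreal ((real r - b)\<^sup>2) \<partial>measure_pmf (map_pmf (\<lambda>s. snd s e) (switch_step N arr p (L, R))))"
    by (simp add: Pair)
  also have "\<dots> = (\<integral>\<^sup>+M. \<integral>\<^sup>+A. ennreal ((real (R e - served N M L (\<lambda>e. 0 < R e) e + A e) - b)\<^sup>2)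
      \<partial>measure_pmf arr \<partial>measure_pmf p)"
    unfolding switch_step_queue by simp
  also have "\<dots> \<le> (\<integral>\<^sup>+M. ennreal (2 * (real (R e) - b)\<^sup>2 + 2 * ?m) \<partial>measure_pmf p)"
    by (intro nn_integral_mono inner)
  also have "\<dots> = ennreal (2 * (real (R e) - b)\<^sup>2 + 2 * ?m)"
    by simp
  finally show ?thesis by (simp add: Pair)
qed

text \<open>Only finiteness matters here: the square of the increment of a queue over \<open>t\<close> slots has an
  expectation bounded independently of the initial state and of \<open>p\<close>.\<close>

lemma chain_queue_square:
  "(\<integral>\<^sup>+s'. ennreal ((real (snd s' e) - real (snd s e))\<^sup>2) \<partial>measure_pmf (chain t s))
     \<le> ennreal (measure_pmf.expectation arr (\<lambda>A. (real (A e) + 1)\<^sup>2) * 4 ^ t)"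
proof (induction t)
  case 0
  then show ?case by simp
next
  case (Suc t)
  let ?m = "measure_pmf.expectation arr (\<lambda>A. (real (A e) + 1)\<^sup>2)"
  have m: "0 \<le> ?m" by (rule Bochner_Integration.integral_nonneg) simp
  have "(\<integral>\<^sup>+s'. ennreal ((real (snd s' e) - real (snd s e))\<^sup>2) \<partial>measure_pmf (chain (Suc t) s))
      = (\<integral>\<^sup>+s''. \<integral>\<^sup>+s'. ennreal ((real (snd s' e) - real (snd s e))\<^sup>2)
           \<partial>measure_pmf (switch_step N arr p s'') \<partial>measure_pmf (chain t s))"
    unfolding evolve_Suc_right by simp
  also have "\<dots> \<le> (\<integral>\<^sup>+s''. ennreal (2 * (real (snd s'' e) - real (snd s e))\<^sup>2 + 2 * ?m) \<partial>measure_pmf (chain t s))"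
    by (intro nn_integral_mono switch_step_queue_square)
  also have "\<dots> = (\<integral>\<^sup>+s''. 2 * ennreal ((real (snd s'' e) - real (snd s e))\<^sup>2) + ennreal (2 * ?m) \<partial>measure_pmf (chain t s))"
    by (intro nn_integral_cong) (use m in \<open>simp add: ennreal_plus ennreal_mult\<close>)
  also have "\<dots> = 2 * (\<integral>\<^sup>+s''. ennreal ((real (snd s'' e) - real (snd s e))\<^sup>2) \<partial>measure_pmf (chain t s)) + ennreal (2 * ?m)"
    by (subst nn_integral_add) (auto simp: nn_integral_cmult)
  also have "\<dots> \<le> 2 * ennreal (?m * 4 ^ t) + ennreal (2 * ?m)"
    by (intro add_right_mono mult_left_mono Suc.IH) simp
  also have "\<dots> = ennreal (2 * (?m * 4 ^ t) + 2 * ?m)"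
    using m by (simp add: ennreal_plus ennreal_mult)
  also have "\<dots> \<le> ennreal (?m * 4 ^ Suc t)"
    using mult_left_mono[OF one_le_power[of "4::real" t] m] by (intro ennreal_leI) (simp add: mult.commute)
  finally show ?case .
qed

lemma chain_queue_square_integrable:
  "integrable (measure_pmf (chain t s)) (\<lambda>s'. (real (snd s' e) - real (snd s e))\<^sup>2)"
  by (rule integrableI_nonneg)
     (auto intro: le_less_trans[OF chain_queue_square])

lemma chain_queue_square_expectation:
  "measure_pmf.expectation (chain t s) (\<lambda>s'. (real (snd s' e) - real (snd s e))\<^sup>2)
     \<le> measure_pmf.expectation arr (\<lambda>A. (real (A e) + 1)\<^sup>2) * 4 ^ t"
proof -
  have "ennreal (measure_pmf.expectation (chain t s) (\<lambda>s'. (real (snd s' e) - real (snd s e))\<^sup>2))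
      \<le> ennreal (measure_pmf.expectation arr (\<lambda>A. (real (A e) + 1)\<^sup>2) * 4 ^ t)"
    using chain_queue_square[where e = e and s = s and t = t]
    by (subst (asm) nn_integral_eq_integral) (auto simp: chain_queue_square_integrable)
  then show ?thesis
    by (subst (asm) ennreal_le_iff) (auto intro!: mult_nonneg_nonneg Bochner_Integration.integral_nonneg)
qed

lemma chain_queue_integrable:
  "integrable (measure_pmf (chain t s)) (\<lambda>s'. real (snd s' e) - real (snd s e))"
  by (rule integrable_pmf_if_square[OF chain_queue_square_integrable])

lemma switch_step_queue_mean:
  "measure_pmf.expectation (switch_step N arr p s) (\<lambda>s'. real (snd s' e) - b)
     = real (snd s e) - b + \<nu> e
       - x e * of_bool (0 < snd s e \<and> 0 < fst s (end_u N e) \<and> 0 < fst s (end_v N e))"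
proof (cases s)
  case (Pair L R)
  let ?o = "of_bool (0 < R e \<and> 0 < L (end_u N e) \<and> 0 < L (end_v N e)) :: real"
  have A: "integrable (measure_pmf arr) (\<lambda>A. real (A e))" "measure_pmf.expectation arr (\<lambda>A. real (A e)) = \<nu> e"
    using arr by (auto simp: request_arrivals_def)
  have "integrable (measure_pmf (switch_step N arr p (L, R))) (\<lambda>s'. (real (snd s' e) - b)\<^sup>2)"
    by (rule integrableI_nonneg) (auto intro: le_less_trans[OF switch_step_queue_square])
  then have "integrable (measure_pmf (switch_step N arr p (L, R))) (\<lambda>s'. real (snd s' e) - b)"
    by (rule integrable_pmf_if_square)
  then have "integrable (measure_pmf (map_pmf (\<lambda>s. snd s e) (switch_step N arr p (L, R)))) (\<lambda>r. real r - b)"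
    by simp
  note int = this[unfolded switch_step_queue]
  have "measure_pmf.expectation (switch_step N arr p s) (\<lambda>s'. real (snd s' e) - b)
      = measure_pmf.expectation (map_pmf (\<lambda>s. snd s e) (switch_step N arr p (L, R))) (\<lambda>r. real r - b)"
    by (simp add: Pair)
  also have "\<dots> = measure_pmf.expectation p (\<lambda>M.
      measure_pmf.expectation arr (\<lambda>A. real (R e - served N M L (\<lambda>e. 0 < R e) e + A e) - b))"
    unfolding switch_step_queue by (subst expectation_bind_pmf[OF int]) simp
  also have "\<dots> = measure_pmf.expectation p (\<lambda>M. (real (R e) - b + \<nu> e) - of_bool (e \<in> M) * ?o)"
  proof (rule Bochner_Integration.integral_cong[OF refl])
    fix M
    have "real (R e - served N M L (\<lambda>e. 0 < R e) e + A e) - b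
        = (real (R e) - of_bool (e \<in> M) * ?o - b) + real (A e)" for A
      by (auto simp: served_def of_nat_diff)
    then show "measure_pmf.expectation arr (\<lambda>A. real (R e - served N M L (\<lambda>e. 0 < R e) e + A e) - b)
        = (real (R e) - b + \<nu> e) - of_bool (e \<in> M) * ?o"
      by (simp add: A)
  qed
  also have "\<dots> = real (R e) - b + \<nu> e - x e * ?o"
    by (simp add: integrable_measure_pmf_finite x)
  finally show ?thesis by (simp add: Pair)
qed

lemma chain_queue_mean_Suc:
  "measure_pmf.expectation (chain (Suc t) s) (\<lambda>s'. real (snd s' e) - b)
     = measure_pmf.expectation (chain t s) (\<lambda>s'. real (snd s' e) - b) + \<nu> e
       - x e * measure_pmf.expectation (chain t s)
           (\<lambda>s'. of_bool (0 < snd s' e \<and> 0 < fst s' (end_u N e) \<and> 0 < fst s' (end_v N e)))"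
proof -
  have int: "integrable (measure_pmf (chain t s)) (\<lambda>s'. real (snd s' e) - b)" for t
    using Bochner_Integration.integrable_add[OF chain_queue_integrable[where t = t and s = s and e = e], of "\<lambda>_. real (snd s e) - b"] by simp
  have int': "integrable (measure_pmf (chain t s))
      (\<lambda>s'. of_bool (0 < snd s' e \<and> 0 < fst s' (end_u N e) \<and> 0 < fst s' (end_v N e)) :: real)"
    by (rule integrable_pmf_unit) auto
  have "measure_pmf.expectation (chain (Suc t) s) (\<lambda>s'. real (snd s' e) - b)
      = measure_pmf.expectation (chain t s) (\<lambda>s''.
          measure_pmf.expectation (switch_step N arr p s'') (\<lambda>s'. real (snd s' e) - b))"
    unfolding evolve_Suc_right
    by (rule expectation_bind_pmf) (use int[of "Suc t"] in \<open>simp only: evolve_Suc_right\<close>)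
  also have "\<dots> = measure_pmf.expectation (chain t s) (\<lambda>s'. real (snd s' e) - b + \<nu> e
       - x e * of_bool (0 < snd s' e \<and> 0 < fst s' (end_u N e) \<and> 0 < fst s' (end_v N e)))"
    unfolding switch_step_queue_mean ..
  also have "\<dots> = measure_pmf.expectation (chain t s) (\<lambda>s'. real (snd s' e) - b) + \<nu> e
       - x e * measure_pmf.expectation (chain t s)
           (\<lambda>s'. of_bool (0 < snd s' e \<and> 0 < fst s' (end_u N e) \<and> 0 < fst s' (end_v N e)))"
    using int[of t] int' by simp
  finally show ?thesis .
qed

lemma marginal_bounds: "0 \<le> x e" "x e \<le> 1"
  using expectation_unit[of "\<lambda>M. of_bool (e \<in> M)" p] x[of e] by auto

lemma chain_queue_ge:
  assumes "s' \<in> set_pmf (chain t s)"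
  shows "snd s e \<le> snd s' e + t"
  using assms
proof (induction t arbitrary: s')
  case (Suc t)
  from Suc.prems obtain L R where LR: "(L, R) \<in> set_pmf (chain t s)" "s' \<in> set_pmf (switch_step N arr p (L, R))"
    unfolding evolve_Suc_right set_bind_pmf by auto
  have "snd s' e \<in> set_pmf (map_pmf (\<lambda>s. snd s e) (switch_step N arr p (L, R)))" using LR(2) by auto
  then obtain M A where "snd s' e = R e - served N M L (\<lambda>e. 0 < R e) e + A"
    unfolding switch_step_queue by auto
  moreover have "served N M L (\<lambda>e. 0 < R e) e \<le> 1" by (simp add: served_def)
  moreover have "snd s e \<le> R e + t" using Suc.IH[OF LR(1)] by simp
  ultimately show ?case by linarith
qed simp

lemma chain_queue_mean_le:
  "measure_pmf.expectation (chain t s) (\<lambda>s'. real (snd s' e) - real (snd s e)) \<le> real t * \<nu> e"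
proof (induction t)
  case (Suc t)
  have "0 \<le> x e * measure_pmf.expectation (chain t s)
           (\<lambda>s'. of_bool (0 < snd s' e \<and> 0 < fst s' (end_u N e) \<and> 0 < fst s' (end_v N e)))"
    by (intro mult_nonneg_nonneg marginal_bounds Bochner_Integration.integral_nonneg) simp
  then show ?case unfolding chain_queue_mean_Suc using Suc by (simp add: algebra_simps)
qed simp

text \<open>A queue that holds at least \<open>t\<close> requests is nonempty at the start of each of the next \<open>t\<close>
  slots, so the scheduled services in them fail only for want of entanglements.\<close>

lemma chain_queue_mean_long_le:
  assumes "t \<le> snd s e"
  shows "measure_pmf.expectation (chain t s) (\<lambda>s'. real (snd s' e) - real (snd s e))
           \<le> real t * \<nu> e - x e * (\<Sum>j<t. ref_available N (end_u N e) j + ref_available N (end_v N e) j - 1)"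
  using assms
proof (induction t)
  case (Suc t)
  have "measure_pmf.expectation (chain t s)
        (\<lambda>s'. of_bool (0 < snd s' e \<and> 0 < fst s' (end_u N e) \<and> 0 < fst s' (end_v N e)) :: real)
      = measure_pmf.expectation (chain t s)
        (\<lambda>s'. of_bool (0 < fst s' (end_u N e) \<and> 0 < fst s' (end_v N e)))"
  proof (rule integral_cong_AE)
    show "AE s' in measure_pmf (chain t s).
        of_bool (0 < snd s' e \<and> 0 < fst s' (end_u N e) \<and> 0 < fst s' (end_v N e))
          = (of_bool (0 < fst s' (end_u N e) \<and> 0 < fst s' (end_v N e)) :: real)"
      unfolding AE_measure_pmf_iff using chain_queue_ge[where t = t and s = s and e = e] Suc.prems by fastforce
  qed auto
  also have "\<dots> \<ge> ref_available N (end_u N e) t + ref_available N (end_v N e) t - 1"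
    by (rule edge_available_ge[OF valid p x node])
  finally have "x e * (ref_available N (end_u N e) t + ref_available N (end_v N e) t - 1)
      \<le> x e * measure_pmf.expectation (chain t s)
        (\<lambda>s'. of_bool (0 < snd s' e \<and> 0 < fst s' (end_u N e) \<and> 0 < fst s' (end_v N e)) :: real)"
    by (rule mult_left_mono) (rule marginal_bounds)
  then show ?case unfolding chain_queue_mean_Suc using Suc by (simp add: algebra_simps)
qed simp

text \<open>The term \<open>T\<^sup>2\<close> absorbs the queues shorter than the frame, which may fail to be served for
  want of requests.\<close>

lemma chain_queue_drift:
  assumes g: "0 \<le> g" "g \<le> 1"
    and avail: "real T * g \<le> (\<Sum>t<T. ref_available N (end_u N e) t + ref_available N (end_v N e) t - 1)"
  shows "real (snd s e) * measure_pmf.expectation (chain T s) (\<lambda>s'. real (snd s' e) - real (snd s e))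
           \<le> real (snd s e) * (real T * (\<nu> e - g * x e)) + (real T)\<^sup>2"
proof (cases "T \<le> snd s e")
  case True
  have "real (snd s e) * measure_pmf.expectation (chain T s) (\<lambda>s'. real (snd s' e) - real (snd s e))
      \<le> real (snd s e) * (real T * \<nu> e - x e * (\<Sum>t<T. ref_available N (end_u N e) t + ref_available N (end_v N e) t - 1))"
    by (rule mult_left_mono[OF chain_queue_mean_long_le[where t=T, OF True]]) simp
  also have "\<dots> \<le> real (snd s e) * (real T * \<nu> e - x e * (real T * g))"
    by (intro mult_left_mono diff_left_mono avail marginal_bounds) simp
  also have "\<dots> = real (snd s e) * (real T * (\<nu> e - g * x e))" by (simp add: algebra_simps)
  finally show ?thesis by (smt (verit) zero_le_power2)
next
  case False
  have "g * x e \<le> 1" using g marginal_bounds[of e] by (simp add: mult_le_one)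
  then have "real (snd s e) * (real T * (g * x e)) \<le> real T * (real T * 1)"
    using False g marginal_bounds[of e] by (intro mult_mono mult_nonneg_nonneg) auto
  moreover have "real (snd s e) * measure_pmf.expectation (chain T s) (\<lambda>s'. real (snd s' e) - real (snd s e))
      \<le> real (snd s e) * (real T * \<nu> e)"
    by (rule mult_left_mono[OF chain_queue_mean_le]) simp
  ultimately show ?thesis by (simp add: algebra_simps power2_eq_square)
qed

lemma lyapunov_diff:
  "lyapunov R' - lyapunov R
     = (\<Sum>e\<in>UNIV. real (R e) * (real (R' e) - real (R e)) + (real (R' e) - real (R e))\<^sup>2 / 2)"
  unfolding lyapunov_def right_diff_distrib[symmetric] sum_subtractf[symmetric] sum_distrib_left
  by (rule sum.cong) (auto simp: power2_eq_square algebra_simps diff_divide_distrib add_divide_distrib)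

lemma chain_lyapunov_integrable:
  "integrable (measure_pmf (chain T s)) (\<lambda>s'. lyapunov (snd s') - lyapunov (snd s))"
  unfolding lyapunov_diff using chain_queue_integrable chain_queue_square_integrable
  by (intro Bochner_Integration.integrable_sum Bochner_Integration.integrable_add
      integrable_mult_right integrable_divide) auto

lemma chain_lyapunov_drift:
  assumes g: "0 \<le> g" "g \<le> 1"
    and avail: "\<And>e. real T * g \<le> (\<Sum>t<T. ref_available N (end_u N e) t + ref_available N (end_v N e) t - 1)"
  shows "measure_pmf.expectation (chain T s) (\<lambda>s'. lyapunov (snd s') - lyapunov (snd s))
     \<le> real T * ((\<Sum>e\<in>UNIV. real (snd s e) * \<nu> e) - g * (\<Sum>e\<in>UNIV. real (snd s e) * x e))
       + (\<Sum>e\<in>UNIV. (real T)\<^sup>2 + measure_pmf.expectation arr (\<lambda>A. (real (A e) + 1)\<^sup>2) * 4 ^ T / 2)"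
proof -
  have "measure_pmf.expectation (chain T s) (\<lambda>s'. lyapunov (snd s') - lyapunov (snd s))
      = (\<Sum>e\<in>UNIV. real (snd s e) * measure_pmf.expectation (chain T s) (\<lambda>s'. real (snd s' e) - real (snd s e))
          + measure_pmf.expectation (chain T s) (\<lambda>s'. (real (snd s' e) - real (snd s e))\<^sup>2) / 2)"
    unfolding lyapunov_diff
    using chain_queue_integrable chain_queue_square_integrable
    by (subst Bochner_Integration.integral_sum)
       (auto intro!: integrable_divide simp del: Bochner_Integration.integral_diff
          integral_diff Bochner_Integration.integrable_diff)
  also have "\<dots> \<le> (\<Sum>e\<in>UNIV. (real (snd s e) * (real T * (\<nu> e - g * x e)) + (real T)\<^sup>2)
          + measure_pmf.expectation arr (\<lambda>A. (real (A e) + 1)\<^sup>2) * 4 ^ T / 2)"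
    by (intro sum_mono add_mono chain_queue_drift g avail divide_right_mono chain_queue_square_expectation) simp
  also have "\<dots> = real T * ((\<Sum>e\<in>UNIV. real (snd s e) * \<nu> e) - g * (\<Sum>e\<in>UNIV. real (snd s e) * x e))
       + (\<Sum>e\<in>UNIV. (real T)\<^sup>2 + measure_pmf.expectation arr (\<lambda>A. (real (A e) + 1)\<^sup>2) * 4 ^ T / 2)"
    by (simp add: sum.distrib sum_subtractf sum_distrib_left right_diff_distrib mult_ac)
  finally show ?thesis .
qed

end

section \<open>Conditioning on the state at the start of a frame\<close>

text \<open>A conditional expectation given a random variable \<open>X\<close> is constant on each level set of \<open>X\<close>, and
  a level set that contains an atom of the law has positive probability. So it can be evaluated
  at every atom.\<close>

lemma nn_cond_exp_pmf:
  fixes P :: "'a pmf" and X :: "'a \<Rightarrow> 'b"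
  assumes h: "h \<in> set_pmf P"
    and f: "(\<integral>\<^sup>+h'. f h' * indicator (X -` {X h}) h' \<partial>measure_pmf P) = c * emeasure (measure_pmf P) (X -` {X h})"
  shows "nn_cond_exp (measure_pmf P) (vimage_algebra UNIV X (count_space UNIV)) f h = c"
proof -
  let ?F = "vimage_algebra UNIV X (count_space UNIV)" and ?A = "X -` {X h}"
  let ?E = "nn_cond_exp (measure_pmf P) ?F f"
  have sub: "subalgebra (measure_pmf P) ?F" by (simp add: subalgebra_def)
  interpret finite_measure_subalgebra "measure_pmf P" ?F by unfold_locales (rule sub)
  have A: "X -` B \<in> sets ?F" for B
    using in_vimage_algebra[of B "count_space UNIV" X UNIV] by simp
  have const: "?E h' = ?E h" if "h' \<in> ?A" for h'
  proof -
    have "?E -` {?E h} \<inter> space ?F \<in> sets ?F"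
      by (rule measurable_sets[OF borel_measurable_nn_cond_exp]) simp
    then have "?E -` {?E h} \<in> sets ?F" by simp
    then obtain B where "?E -` {?E h} = X -` B" by (auto simp: sets_vimage_algebra2)
    then show ?thesis using that by blast
  qed
  have "?E h * emeasure (measure_pmf P) ?A = (\<integral>\<^sup>+h'. ?E h * indicator ?A h' \<partial>measure_pmf P)"
    by (simp add: nn_integral_cmult)
  also have "\<dots> = (\<integral>\<^sup>+h'. indicator ?A h' * ?E h' \<partial>measure_pmf P)"
  proof (rule nn_integral_cong)
    fix h'
    show "?E h * indicator ?A h' = indicator ?A h' * ?E h'"
    proof (cases "h' \<in> ?A")
      case True
      show ?thesis using const[OF True] True by simp
    qed simp
  qed
  also have "\<dots> = (\<integral>\<^sup>+h'. indicator ?A h' * f h' \<partial>measure_pmf P)"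
    by (rule nn_cond_exp_intg) (use A in auto)
  also have "\<dots> = c * emeasure (measure_pmf P) ?A"
    using f by (simp add: mult.commute)
  finally have eq: "?E h * emeasure (measure_pmf P) ?A = c * emeasure (measure_pmf P) ?A" .
  have "emeasure (measure_pmf P) ?A \<noteq> 0"
    using h by (auto simp: measure_pmf.emeasure_eq_measure measure_pmf_zero_iff)
  then have "?E h * (emeasure (measure_pmf P) ?A / emeasure (measure_pmf P) ?A)
      = c * (emeasure (measure_pmf P) ?A / emeasure (measure_pmf P) ?A)"
    using eq by (simp add: ennreal_times_divide)
  moreover have "emeasure (measure_pmf P) ?A / emeasure (measure_pmf P) ?A = 1"
    using \<open>emeasure (measure_pmf P) ?A \<noteq> 0\<close>
    by (intro ennreal_divide_self) (auto simp: measure_pmf.emeasure_eq_measure)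
  ultimately show ?thesis by simp
qed

text \<open>If \<open>Y\<close> is generated from \<open>X\<close> by a kernel, the conditional expectation given \<open>X\<close> is the
  expectation under that kernel. Only integrability under the kernel at the observed value is
  needed, so \<open>X\<close> itself may have no moments.\<close>

lemma real_cond_exp_kernel:
  fixes P :: "'a pmf" and X :: "'a \<Rightarrow> 'b" and Y :: "'a \<Rightarrow> 'c" and \<phi> :: "'b \<Rightarrow> 'c \<Rightarrow> real"
  assumes joint: "map_pmf (\<lambda>h. (X h, Y h)) P = bind_pmf q (\<lambda>a. map_pmf (Pair a) (K a))"
    and h: "h \<in> set_pmf P"
    and int: "integrable (measure_pmf (K (X h))) (\<phi> (X h))"
  shows "real_cond_exp (measure_pmf P) (vimage_algebra UNIV X (count_space UNIV)) (\<lambda>h. \<phi> (X h) (Y h)) h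
           = measure_pmf.expectation (K (X h)) (\<phi> (X h))"
proof -
  have restrict: "(\<integral>\<^sup>+h'. ennreal (\<psi> (X h') (Y h')) * indicator (X -` {X h}) h' \<partial>measure_pmf P)
      = (\<integral>\<^sup>+y. ennreal (\<psi> (X h) y) \<partial>measure_pmf (K (X h))) * emeasure (measure_pmf q) {X h}"
    for \<psi> :: "'b \<Rightarrow> 'c \<Rightarrow> real"
  proof -
    have "(\<integral>\<^sup>+h'. ennreal (\<psi> (X h') (Y h')) * indicator (X -` {X h}) h' \<partial>measure_pmf P)
        = (\<integral>\<^sup>+z. ennreal (\<psi> (fst z) (snd z)) * indicator {X h} (fst z) \<partial>measure_pmf (map_pmf (\<lambda>h. (X h, Y h)) P))"
      by (auto intro!: nn_integral_cong split: split_indicator)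
    also have "\<dots> = (\<integral>\<^sup>+a. \<integral>\<^sup>+y. ennreal (\<psi> a y) * indicator {X h} a \<partial>measure_pmf (K a) \<partial>measure_pmf q)"
      unfolding joint by simp
    also have "\<dots> = (\<integral>\<^sup>+a. (\<integral>\<^sup>+y. ennreal (\<psi> (X h) y) \<partial>measure_pmf (K (X h))) * indicator {X h} a \<partial>measure_pmf q)"
      by (intro nn_integral_cong) (auto split: split_indicator)
    also have "\<dots> = (\<integral>\<^sup>+y. ennreal (\<psi> (X h) y) \<partial>measure_pmf (K (X h))) * emeasure (measure_pmf q) {X h}"
      by (simp add: nn_integral_cmult)
    finally show ?thesis .
  qed
  have mass: "emeasure (measure_pmf P) (X -` {X h}) = emeasure (measure_pmf q) {X h}"
    using restrict[of "\<lambda>_ _. 1"] by simp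
  have cond: "nn_cond_exp (measure_pmf P) (vimage_algebra UNIV X (count_space UNIV))
      (\<lambda>h. ennreal (\<psi> (X h) (Y h))) h = (\<integral>\<^sup>+y. ennreal (\<psi> (X h) y) \<partial>measure_pmf (K (X h)))"
    for \<psi> :: "'b \<Rightarrow> 'c \<Rightarrow> real"
    by (rule nn_cond_exp_pmf[OF h]) (simp only: restrict mass)
  show ?thesis
    unfolding real_cond_exp_def cond[of \<phi>] cond[of "\<lambda>a y. - \<phi> a y"]
    by (rule real_lebesgue_integral_def[OF int, symmetric])
qed

lemma length_switch_traj:
  "h \<in> set_pmf (switch_traj N arr T p init t) \<Longrightarrow> length h = Suc t"
  by (induction t arbitrary: h) auto

text \<open>Within a frame the matching law is fixed, so the state evolves as a homogeneous chain.\<close>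

lemma switch_traj_frame:
  assumes "n \<le> T"
  shows "map_pmf (\<lambda>h. (h ! (k * T), h ! (k * T + n))) (switch_traj N arr T p init (k * T + n))
    = bind_pmf (map_pmf (\<lambda>h. h ! (k * T)) (switch_traj N arr T p init (k * T)))
        (\<lambda>s. map_pmf (Pair s) (evolve (switch_step N arr (p (snd s))) n (return_pmf s)))"
  using assms
proof (induction n)
  case 0
  then show ?case by (simp add: map_pmf_def bind_assoc_pmf bind_return_pmf)
next
  case (Suc n)
  let ?t = "k * T + n"
  let ?step = "\<lambda>a. switch_step N arr (p (snd a))"
  have start: "?t div T * T = k * T" using Suc.prems by simp
  have "map_pmf (\<lambda>h. (h ! (k * T), h ! (k * T + Suc n))) (switch_traj N arr T p init (k * T + Suc n))
      = bind_pmf (switch_traj N arr T p init ?t) (\<lambda>h.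
          map_pmf (\<lambda>s. ((h @ [s]) ! (k * T), (h @ [s]) ! Suc ?t)) (?step (h ! (k * T)) (h ! ?t)))"
    by (simp add: map_bind_pmf start map_pmf_def bind_assoc_pmf bind_return_pmf)
  also have "\<dots> = bind_pmf (switch_traj N arr T p init ?t) (\<lambda>h.
          map_pmf (Pair (h ! (k * T))) (?step (h ! (k * T)) (h ! ?t)))"
    by (intro bind_pmf_cong refl map_pmf_cong)
       (auto dest!: length_switch_traj simp: nth_append)
  also have "\<dots> = bind_pmf (map_pmf (\<lambda>h. (h ! (k * T), h ! ?t)) (switch_traj N arr T p init ?t))
          (\<lambda>(a, b). map_pmf (Pair a) (?step a b))"
    by (simp add: bind_map_pmf)
  also have "\<dots> = bind_pmf (map_pmf (\<lambda>h. h ! (k * T)) (switch_traj N arr T p init (k * T)))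
        (\<lambda>s. map_pmf (Pair s) (evolve (?step s) (Suc n) (return_pmf s)))"
    using Suc by (simp add: bind_assoc_pmf bind_map_pmf map_bind_pmf evolve_Suc_right del: evolve.simps(2))
  finally show ?case .
qed

lemma frame_drift_eq:
  assumes "h \<in> set_pmf (switch_traj N arr T p init ((k + 1) * T))"
    and "integrable (measure_pmf (evolve (switch_step N arr (p (snd (h ! (k * T))))) T (return_pmf (h ! (k * T)))))
           (\<lambda>s. lyapunov (snd s) - lyapunov (snd (h ! (k * T))))"
  shows "frame_drift N arr T p init k h
    = measure_pmf.expectation (evolve (switch_step N arr (p (snd (h ! (k * T))))) T (return_pmf (h ! (k * T))))
           (\<lambda>s. lyapunov (snd s) - lyapunov (snd (h ! (k * T))))"
proof -
  have t: "k * T + T = (k + 1) * T" by simp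
  show ?thesis unfolding frame_drift_def
    by (rule real_cond_exp_kernel[where X = "\<lambda>h. h ! (k * T)" and Y = "\<lambda>h. h ! ((k + 1) * T)"
          and K = "\<lambda>s. evolve (switch_step N arr (p (snd s))) T (return_pmf s)"
          and \<phi> = "\<lambda>a s. lyapunov (snd s) - lyapunov (snd a)", OF _ assms])
       (rule switch_traj_frame[OF order_refl[of T], of k N arr p init, unfolded t])
qed

section \<open>Choice of the frame length\<close>

text \<open>Every nonnegative \<open>g\<close> below the coherence factor is reached by the mean edge availability over a
  sufficiently long frame, for all edges at once.\<close>

lemma frame_length_exists:
  fixes N :: "('v::finite, 'e::finite) switch"
  assumes "valid_switch N" and g: "g < gamma_coh N" "0 \<le> g"
  obtains T where "1 \<le> T"
    "\<And>e. real T * g \<le> (\<Sum>t<T. ref_available N (end_u N e) t + ref_available N (end_v N e) t - 1)"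
proof -
  have "\<exists>c\<ge>0. \<forall>T. real T * availability N v - c \<le> (\<Sum>t<T. ref_available N v t)" for v
    using sum_ref_available_ge[OF assms(1)] by metis
  then obtain c where c: "\<And>v. 0 \<le> c v"
    "\<And>v T. real T * availability N v - c v \<le> (\<Sum>t<T. ref_available N v t)" by metis
  define C where "C = (\<Sum>v\<in>UNIV. c v)"
  have cC: "c v \<le> C" for v unfolding C_def by (rule member_le_sum) (use c in auto)
  obtain T :: nat where T: "2 * C / (gamma_coh N - g) < real T" using reals_Archimedean2 by blast
  have T0: "0 \<le> C" unfolding C_def by (rule sum_nonneg) (use c in auto)
  have ge: "2 * C \<le> real T * (gamma_coh N - g)"
    using T g by (simp add: divide_less_eq less_imp_le)
  have "real T > 0" using T T0 g by (smt (verit) divide_nonneg_pos)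
  then have "1 \<le> T" by simp
  moreover have "real T * g \<le> (\<Sum>t<T. ref_available N (end_u N e) t + ref_available N (end_v N e) t - 1)" for e
  proof -
    have "gamma_coh N \<le> max 0 (availability N (end_u N e) + availability N (end_v N e) - 1)"
      unfolding gamma_coh_def by (rule Min_le) auto
    then have "gamma_coh N \<le> availability N (end_u N e) + availability N (end_v N e) - 1"
      using g by (simp add: max_def split: if_splits)
    then have "real T * gamma_coh N \<le> real T * (availability N (end_u N e) + availability N (end_v N e) - 1)"
      by (rule mult_left_mono) simp
    then have "real T * g \<le> (real T * availability N (end_u N e) - C) + (real T * availability N (end_v N e) - C) - real T"
      using ge by (simp add: algebra_simps)
    also have "\<dots> \<le> (\<Sum>t<T. ref_available N (end_u N e) t) + (\<Sum>t<T. ref_available N (end_v N e) t) - real T"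
      using c(2)[of T "end_u N e"] c(2)[of T "end_v N e"] cC[of "end_u N e"] cC[of "end_v N e"] by linarith
    also have "\<dots> = (\<Sum>t<T. ref_available N (end_u N e) t + ref_available N (end_v N e) t - 1)"
      by (simp add: sum.distrib sum_subtractf)
    finally show ?thesis .
  qed
  ultimately show ?thesis using that by blast
qed

lemma gamma_coh_le_1:
  fixes N :: "('v::finite, 'e::finite) switch"
  shows "gamma_coh N \<le> 1"
proof -
  obtain e :: 'e where True by simp
  have "gamma_coh N \<le> max 0 (availability N (end_u N e) + availability N (end_v N e) - 1)"
    unfolding gamma_coh_def by (rule Min_le) auto
  also have "\<dots> \<le> 1"
    using pmf_nonneg[of "stationary_dist {0..buf N (end_u N e)} (ref_step N (end_u N e))" 0]
      pmf_nonneg[of "stationary_dist {0..buf N (end_v N e)} (ref_step N (end_v N e))" 0]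
    unfolding availability_def by linarith
  finally show ?thesis .
qed

lemma lp_frame_rule_marginal:
  assumes "lp_frame_rule N xs p"
  shows "measure_pmf.expectation (p R) (\<lambda>M. of_bool (e \<in> M)) = xs R e"
proof -
  have "measure_pmf.expectation (p R) (\<lambda>M. of_bool (e \<in> M))
      = (\<Sum>M\<in>matchings N. of_bool (e \<in> M) * pmf (p R) M)"
    by (rule integral_measure_pmf_real) (use assms in \<open>auto simp: lp_frame_rule_def\<close>)
  also have "\<dots> = (\<Sum>M\<in>matchings N. pmf (p R) M * indicator M e)"
    by (rule sum.cong) (auto simp: indicator_def)
  also have "\<dots> = xs R e" using assms by (simp add: lp_frame_rule_def)
  finally show ?thesis .
qed

section \<open>Negative drift\<close>

theorem theorem1:
  fixes N :: "('v::finite, 'e::finite) switch"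
    and arr :: "('e \<Rightarrow> nat) pmf"
    and \<nu> \<sigma> :: "'e \<Rightarrow> real"
    and \<epsilon> :: real
  assumes "valid_switch N"
    and "request_arrivals arr \<nu> \<sigma>"
    and "gamma_coh N > 0"
    and "\<epsilon> > 0"
    and "(\<lambda>e. (1 + \<epsilon>) / gamma_coh N * \<nu> e) \<in> capacity_region N"
  shows "\<exists>(T::nat) (\<delta>::real) (\<B> :: ('e \<Rightarrow> nat) set).
           T \<ge> 1 \<and> \<delta> > 0 \<and> finite \<B> \<and>
           (\<forall>xs p init. lp_frame_rule N xs p \<longrightarrow> set_pmf init \<subseteq> mem_states N \<times> UNIV \<longrightarrow>
              (\<forall>k. AE h in measure_pmf (switch_traj N arr T p init ((k + 1) * T)).
                 snd (h ! (k * T)) \<notin> \<B> \<longrightarrow> frame_drift N arr T p init k h \<le> - \<delta>))"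
proof -
  \<comment> \<open>The availability \<open>g\<close> aimed at within a frame spends exactly the factor \<open>1 + \<epsilon>\<close> of the margin.\<close>
  define g where "g = gamma_coh N / (1 + \<epsilon>)"
  have g: "0 < g" "g < gamma_coh N" "g \<le> 1"
  proof -
    show "0 < g" using assms(3,4) by (simp add: g_def)
    show "g < gamma_coh N" using assms(3,4) by (simp add: g_def divide_less_eq)
    then show "g \<le> 1" using gamma_coh_le_1[of N] by linarith
  qed
  obtain r where r: "lp_feasible N r" "\<And>e. (1 + \<epsilon>) / gamma_coh N * \<nu> e < r e"
    using capacity_region_dominated[OF assms(1,5)] by blast
  have slack: "\<nu> e < g * r e" for e
  proof -
    have "g * ((1 + \<epsilon>) / gamma_coh N * \<nu> e) < g * r e"
      by (rule mult_strict_left_mono[OF r(2) g(1)])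
    then show ?thesis using assms(3,4) by (simp add: g_def)
  qed
  \<comment> \<open>The capacity region is defined by strict inequalities. The slack \<open>c\<close> gives a negative drift also
    along edges without arrivals, where the factor \<open>1 + \<epsilon>\<close> yields nothing.\<close>
  define c where "c = Min (range (\<lambda>e. g * r e - \<nu> e))"
  have c0: "0 < c" unfolding c_def using slack by (subst Min_gr_iff) auto
  have c: "\<nu> e + c \<le> g * r e" for e
  proof -
    have "c \<le> g * r e - \<nu> e" unfolding c_def by (rule Min_le) auto
    then show ?thesis by linarith
  qed
  obtain T where T: "1 \<le> T"
    and avail: "\<And>e. real T * g \<le> (\<Sum>t<T. ref_available N (end_u N e) t + ref_available N (end_v N e) t - 1)"
    using frame_length_exists[OF assms(1) g(2)] g(1) by (metis less_imp_le)
  \<comment> \<open>\<open>D\<close> bounds the part of the drift that does not depend on the queue lengths.\<close>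
  define D where "D = (\<Sum>e\<in>UNIV. (real T)\<^sup>2 + measure_pmf.expectation arr (\<lambda>A. (real (A e) + 1)\<^sup>2) * 4 ^ T / 2)"
  define \<B> where "\<B> = {R :: 'e \<Rightarrow> nat. real T * c * (\<Sum>e\<in>UNIV. real (R e)) < D + 1}"
  have "finite \<B>"
  proof (rule finite_subset)
    let ?b = "nat \<lceil>(D + 1) / (real T * c)\<rceil>"
    show "\<B> \<subseteq> PiE UNIV (\<lambda>_. {..?b})"
    proof
      fix R assume "R \<in> \<B>"
      then have "(\<Sum>e\<in>UNIV. real (R e)) < (D + 1) / (real T * c)"
        using T c0 by (simp add: \<B>_def pos_less_divide_eq mult.commute)
      moreover have "real (R e) \<le> (\<Sum>e\<in>UNIV. real (R e))" for e by (rule member_le_sum) auto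
      ultimately have "real (R e) \<le> (D + 1) / (real T * c)" for e by (meson le_less_trans less_imp_le)
      then have "R e \<le> ?b" for e by (metis le_nat_iff ceiling_mono ceiling_of_nat nat_mono nat_int)
      then show "R \<in> PiE UNIV (\<lambda>_. {..?b})" by auto
    qed
  qed (simp add: finite_PiE)
  moreover have "frame_drift N arr T p init k h \<le> - 1"
    if rule: "lp_frame_rule N xs p"
      and h: "h \<in> set_pmf (switch_traj N arr T p init ((k + 1) * T))" "snd (h ! (k * T)) \<notin> \<B>"
    for xs p init k h
  proof -
    define R where "R = snd (h ! (k * T))"
    have opt: "lp_optimal N (\<lambda>e. real (R e)) (xs R)" and pR: "set_pmf (p R) \<subseteq> matchings N"
      using rule by (auto simp: lp_frame_rule_def)
    have node: "(\<Sum>e\<in>incident N v. xs R e) \<le> lam N v" for v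
      using opt by (simp add: lp_optimal_def lp_feasible_def)
    note ctx = assms(1,2) pR lp_frame_rule_marginal[OF rule, of R] node
    \<comment> \<open>The only use of the optimality of the schedule: \<open>r\<close> competes in the same LP.\<close>
    have weight: "(\<Sum>e\<in>UNIV. real (R e) * r e) \<le> (\<Sum>e\<in>UNIV. real (R e) * xs R e)"
      using opt r(1) by (simp add: lp_optimal_def)
    have "frame_drift N arr T p init k h
        = measure_pmf.expectation (evolve (switch_step N arr (p R)) T (return_pmf (h ! (k * T))))
           (\<lambda>s. lyapunov (snd s) - lyapunov (snd (h ! (k * T))))"
      unfolding R_def
      by (rule frame_drift_eq[OF h(1)]) (rule chain_lyapunov_integrable[OF ctx, unfolded R_def])
    also have "\<dots> \<le> real T * ((\<Sum>e\<in>UNIV. real (R e) * \<nu> e) - g * (\<Sum>e\<in>UNIV. real (R e) * xs R e)) + D"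
      unfolding D_def
      using chain_lyapunov_drift[OF ctx _ g(3) avail, where s = "h ! (k * T)"] g(1)
      by (simp add: R_def less_imp_le)
    also have "\<dots> \<le> real T * ((\<Sum>e\<in>UNIV. real (R e) * \<nu> e) - g * (\<Sum>e\<in>UNIV. real (R e) * r e)) + D"
      by (rule add_right_mono, rule mult_left_mono, rule diff_left_mono,
          rule mult_left_mono[OF weight less_imp_le[OF g(1)]]) simp
    also have "(\<Sum>e\<in>UNIV. real (R e) * \<nu> e) - g * (\<Sum>e\<in>UNIV. real (R e) * r e)
        = (\<Sum>e\<in>UNIV. real (R e) * (\<nu> e - g * r e))"
      by (simp add: sum_distrib_left sum_subtractf algebra_simps)
    also have "real T * (\<Sum>e\<in>UNIV. real (R e) * (\<nu> e - g * r e)) + D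
        \<le> real T * (\<Sum>e\<in>UNIV. real (R e) * (- c)) + D"
    proof (intro add_right_mono mult_left_mono sum_mono)
      fix e show "\<nu> e - g * r e \<le> - c" using c[of e] by simp
    qed auto
    also have "\<dots> = D - real T * c * (\<Sum>e\<in>UNIV. real (R e))"
      by (simp add: sum_distrib_left sum_negf mult_ac)
    also have "\<dots> \<le> - 1"
      using h(2) by (simp add: \<B>_def R_def)
    finally show ?thesis .
  qed
  ultimately have "T \<ge> 1 \<and> (1::real) > 0 \<and> finite \<B> \<and>
           (\<forall>xs p init. lp_frame_rule N xs p \<longrightarrow> set_pmf init \<subseteq> mem_states N \<times> UNIV \<longrightarrow>
              (\<forall>k. AE h in measure_pmf (switch_traj N arr T p init ((k + 1) * T)).
                 snd (h ! (k * T)) \<notin> \<B> \<longrightarrow> frame_drift N arr T p init k h \<le> - 1))"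
    using T unfolding AE_measure_pmf_iff by (metis zero_less_one)
  then show ?thesis by blast
qed

end
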